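(* Every local thrackle on $n$ vertices with $x$-monotone edges has at most $\frac{4}{3}n$ edges. Moreover, there is an absolute constant $C$ such that for every positive integer $n$ there exists a local thrackle on $n$ vertices with $x$-monotone edges and with at least $\frac{6}{5}n - C$ edges.
   Context: A topological graph is a (finite) graph drawn in the plane such that its vertices are represented by points and its edges by non-self-intersecting arcs connecting the corresponding points. No edge passes through a point representing a vertex other than its endpoints. Tangencies between edges are not allowed: if two edges share an interior point, they properly cross at this point. A topological graph is simple if every pair of its edges intersect at most once: at a common endpoint or at a proper crossing. A path of length $3$ consists of $4$ distinct vertices and $3$ edges; it is plane if no two of its edges cross. A local thrackle is a simple topological graph with no plane path of length $3$. An edge (arc) is $x$-monotone if every vertical line meets it in at most one point. *)

theory Defs
  imports "HOL-Analysis.Analysis"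
begin

type_synonym plane = "real \<times> real"

text \<open>
  Vertices are points of the plane, and an edge is the two-element set of its end vertices. The
  arc representing the edge \<open>e\<close> is the image of the path \<open>curve G e\<close>; the value of \<open>curve G\<close> at
  arguments that are not edges is irrelevant.
\<close>

record topgraph =
  verts :: "plane set"
  edges :: "plane set set"
  curve :: "plane set \<Rightarrow> real \<Rightarrow> plane"

definition arc_interior :: "(real \<Rightarrow> plane) \<Rightarrow> plane set" where
  "arc_interior g = path_image g - {pathstart g, pathfinish g}"

text \<open>
  Two arcs cross properly at \<open>p\<close> (each passes from one side of the other to its other side) if a
  homeomorphism from a neighbourhood of \<open>p\<close> onto the open unit disc carries \<open>p\<close> to the centre and
  the two arcs to the horizontal and the vertical diameter. In particular \<open>p\<close> is then an interior
  point of both arcs and an isolated point of their intersection.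
\<close>

definition properly_cross_at :: "plane \<Rightarrow> (real \<Rightarrow> plane) \<Rightarrow> (real \<Rightarrow> plane) \<Rightarrow> bool" where
  "properly_cross_at p g1 g2 \<longleftrightarrow>
     (\<exists>U (h :: plane \<Rightarrow> plane) k. open U \<and> p \<in> U \<and> homeomorphism U (ball 0 1) h k \<and> h p = 0 \<and>
        h ` (path_image g1 \<inter> U) = {z \<in> ball 0 1. snd z = 0} \<and>
        h ` (path_image g2 \<inter> U) = {z \<in> ball 0 1. fst z = 0})"

definition arcs_cross :: "(real \<Rightarrow> plane) \<Rightarrow> (real \<Rightarrow> plane) \<Rightarrow> bool" where
  "arcs_cross g1 g2 \<longleftrightarrow> (\<exists>p. properly_cross_at p g1 g2)"

definition topological_graph :: "topgraph \<Rightarrow> bool" where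
  "topological_graph G \<longleftrightarrow>
     finite (verts G) \<and>
     (\<forall>e \<in> edges G. e \<subseteq> verts G \<and> card e = 2) \<and>
     (\<forall>e \<in> edges G. arc (curve G e) \<and> {pathstart (curve G e), pathfinish (curve G e)} = e) \<and>
     (\<forall>e \<in> edges G. path_image (curve G e) \<inter> verts G \<subseteq> e) \<and>
     (\<forall>e \<in> edges G. \<forall>f \<in> edges G. e \<noteq> f \<longrightarrow>
        (\<forall>p \<in> arc_interior (curve G e) \<inter> arc_interior (curve G f).
           properly_cross_at p (curve G e) (curve G f)))"

text \<open>
  By the conditions on topological graphs, the only common point permitted here is automatically
  a common endpoint or a proper crossing.
\<close>

definition simple_topological_graph :: "topgraph \<Rightarrow> bool" where
  "simple_topological_graph G \<longleftrightarrow>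
     topological_graph G \<and>
     (\<forall>e \<in> edges G. \<forall>f \<in> edges G. e \<noteq> f \<longrightarrow>
        (\<forall>p \<in> path_image (curve G e) \<inter> path_image (curve G f).
         \<forall>q \<in> path_image (curve G e) \<inter> path_image (curve G f). p = q))"

definition path3 :: "topgraph \<Rightarrow> plane \<Rightarrow> plane \<Rightarrow> plane \<Rightarrow> plane \<Rightarrow> bool" where
  "path3 G a b c d \<longleftrightarrow>
     distinct [a, b, c, d] \<and> {a, b} \<in> edges G \<and> {b, c} \<in> edges G \<and> {c, d} \<in> edges G"

definition plane_path3 :: "topgraph \<Rightarrow> plane \<Rightarrow> plane \<Rightarrow> plane \<Rightarrow> plane \<Rightarrow> bool" where
  "plane_path3 G a b c d \<longleftrightarrow>
     path3 G a b c d \<and>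
     (\<forall>e \<in> {{a, b}, {b, c}, {c, d}}. \<forall>f \<in> {{a, b}, {b, c}, {c, d}}. e \<noteq> f \<longrightarrow>
        \<not> arcs_cross (curve G e) (curve G f))"

definition local_thrackle :: "topgraph \<Rightarrow> bool" where
  "local_thrackle G \<longleftrightarrow>
     simple_topological_graph G \<and> \<not> (\<exists>a b c d. plane_path3 G a b c d)"

definition x_monotone :: "(real \<Rightarrow> plane) \<Rightarrow> bool" where
  "x_monotone g \<longleftrightarrow>
     (\<forall>x. \<forall>p \<in> path_image g. \<forall>q \<in> path_image g. fst p = x \<and> fst q = x \<longrightarrow> p = q)"

definition x_monotone_edges :: "topgraph \<Rightarrow> bool" where
  "x_monotone_edges G \<longleftrightarrow> (\<forall>e \<in> edges G. x_monotone (curve G e))"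

end

theory Submission
  imports Defs
begin

text \<open>
  \<^bold>\<open>Upper bound.\<close> An \<open>x\<close>-monotone edge is the graph of a continuous function on an interval. Two edges
  that leave a vertex to the same side meet nowhere else, so one of them stays above the other. Suppose
  that an edge \<open>bc\<close>, with \<open>b\<close> to the left of \<open>c\<close>, has some edge \<open>ba\<close> above it at \<open>b\<close> and some edge
  \<open>cd\<close> below it at \<open>c\<close>. Then \<open>bc\<close> separates \<open>ab\<close> from \<open>cd\<close>, and \<open>abcd\<close> is a plane path
  (\<open>not_above_and_below\<close>). So in a local thrackle every edge is the topmost edge leaving its left end
  to the right or the lowest edge leaving its right end to the left. There is at most one edge of the
  former kind for each vertex with an edge to the right and one of the latter kind for each vertex with
  an edge to the left (\<open>card_E_le\<close>). Hence the number of edges exceeds the number of vertices by at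
  most the number of two-sided vertices, which have edges to both sides. These are rare: an edge cannot
  cross an edge over a disjoint range of abscissae, so a neighbour of a two-sided vertex is one-sided
  (\<open>neighbour_left\<close>, \<open>neighbour_right\<close>), and two two-sided vertices have no common neighbour
  (\<open>disjoint_stars\<close>). Choosing a left and a right neighbour for each of them shows that at most a
  third of all vertices is two-sided.

  \<^bold>\<open>Lower bound.\<close> The vertices are placed at consecutive integer points of the horizontal axis, and an
  edge is a zigzag, the graph of a piecewise linear function with integer values at integer abscissae.
  Two zigzags are disjoint apart from common ends if their difference keeps its sign at the integer
  abscissae (\<open>below_meet\<close>), and they cross properly in their only common point if it changes sign
  exactly once (\<open>swap_meet\<close>). So it is a finite computation that a given list of zigzags draws a local
  thrackle (\<open>zigzag_graph\<close>). The list \<open>triangle_chain\<close> draws three triangles and two further edges on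
  nine vertices. Disjoint translates of this drawing give \<open>11/9\<close> edges per vertex, up to a constant
  for the at most eight vertices that remain, and \<open>11/9 > 6/5\<close>.
\<close>

section \<open>Arcs, crossings and \<open>x\<close>-monotonicity\<close>

lemma injective_interval_interior_not_extremal:
  fixes \<phi> :: "real \<Rightarrow> real"
  assumes "continuous_on {-1<..<1} \<phi>" "inj_on \<phi> {-1<..<1}"
  shows "\<exists>s\<in>{-1<..<1}. \<exists>t\<in>{-1<..<1}. \<phi> s < \<phi> 0 \<and> \<phi> 0 < \<phi> t"
proof -
  have "{-1/2..1/2} \<subseteq> {-1<..<1::real}" by auto
  then have "continuous_on {-1/2..1/2} \<phi>" "inj_on \<phi> {-1/2..1/2}"
    using assms continuous_on_subset inj_on_subset by blast+
  from continuous_inj_imp_mono[OF _ _ this, of 0]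
  have "\<phi> (-1/2) < \<phi> 0 \<and> \<phi> 0 < \<phi> (1/2) \<or> \<phi> (1/2) < \<phi> 0 \<and> \<phi> 0 < \<phi> (-1/2)" by simp
  moreover have "-1/2 \<in> {-1<..<1::real}" "1/2 \<in> {-1<..<1::real}" by auto
  ultimately show ?thesis by blast
qed

text \<open>
  Following the first arc through the homeomorphism, along the horizontal diameter, the parameter of the
  arc is a continuous injective function on an open interval. It is monotone, so its value at the centre
  is neither the least nor the greatest parameter.
\<close>

lemma properly_cross_at_interior:
  assumes cr: "properly_cross_at p g1 g2" and arc: "arc g1"
  shows "p \<in> arc_interior g1" and "p \<in> path_image g2"
proof -
  from cr obtain U and h k :: "plane \<Rightarrow> plane" where
    U: "open U" "p \<in> U" "homeomorphism U (ball 0 1) h k" "h p = 0"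
    and h1: "h ` (path_image g1 \<inter> U) = {z \<in> ball 0 1. snd z = 0}"
    and h2: "h ` (path_image g2 \<inter> U) = {z \<in> ball 0 1. fst z = 0}"
    unfolding properly_cross_at_def by blast
  have kh: "k (h z) = z" if "z \<in> U" for z using U(3) that unfolding homeomorphism_def by blast
  have in_image: "p \<in> path_image g" if zero: "0 \<in> h ` (path_image g \<inter> U)" for g
  proof -
    from zero obtain z where z: "z \<in> path_image g" "z \<in> U" "h z = 0" by auto
    then have "z = p" using kh[OF z(2)] kh[OF U(2)] U(4) by simp
    with z show ?thesis by simp
  qed
  show "p \<in> path_image g2" by (rule in_image) (simp add: h2)
  have p1: "p \<in> path_image g1" by (rule in_image) (simp add: h1)
  define \<gamma> where "\<gamma> = the_inv_into {0..1} g1"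
  have g\<gamma>: "g1 (\<gamma> z) = z" "\<gamma> z \<in> {0..1}" if "z \<in> path_image g1" for z
    using that arc f_the_inv_into_f[of g1 "{0..1}" z] the_inv_into_into[of g1 "{0..1}" z "{0..1}"]
    by (simp_all only: \<gamma>_def path_image_def arc_def subset_refl)
  have cont\<gamma>: "continuous_on (path_image g1) \<gamma>"
    unfolding \<gamma>_def path_image_def
    using arc continuous_on_inv_into[of "{0..1}" g1] by (simp add: arc_def path_def)
  have kz: "k (t, 0) \<in> path_image g1" if "t \<in> {-1<..<1}" for t
  proof -
    have "(t, 0) \<in> h ` (path_image g1 \<inter> U)" unfolding h1 using that by (simp add: norm_Pair abs_less_iff)
    then show ?thesis using kh by auto
  qed
  have tb: "(t, 0::real) \<in> ball 0 1" if "t \<in> {-1<..<1::real}" for t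
    using that by (simp add: norm_Pair abs_less_iff)
  have "continuous_on (ball 0 1) k" using U(3) unfolding homeomorphism_def by blast
  then have ck: "continuous_on {-1<..<1} (\<lambda>t. k (t, 0))"
    by (rule continuous_on_compose2) (use tb in \<open>auto simp del: mem_ball intro: continuous_intros\<close>)
  have "continuous_on {-1<..<1} (\<lambda>t. \<gamma> (k (t, 0)))"
    by (rule continuous_on_compose2[OF cont\<gamma> ck]) (use kz in blast)
  moreover have "inj_on (\<lambda>t. \<gamma> (k (t, 0))) {-1<..<1}"
  proof (rule inj_onI)
    fix s t :: real assume st: "s \<in> {-1<..<1}" "t \<in> {-1<..<1}" "\<gamma> (k (s, 0)) = \<gamma> (k (t, 0))"
    then have "k (s, 0) = k (t, 0)" using g\<gamma>(1) kz by metis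
    moreover have "h (k z) = z" if "z \<in> ball 0 1" for z
      using U(3) that unfolding homeomorphism_def by blast
    ultimately show "s = t" using tb st by (metis Pair_inject)
  qed
  ultimately obtain s t where st: "s \<in> {-1<..<1}" "t \<in> {-1<..<1}"
    "\<gamma> (k (s, 0)) < \<gamma> (k (0, 0))" "\<gamma> (k (0, 0)) < \<gamma> (k (t, 0))"
    using injective_interval_interior_not_extremal[of "\<lambda>t. \<gamma> (k (t, 0))"] by blast
  have "k (0, 0) = p" using kh[OF U(2)] U(4) by (simp add: zero_prod_def)
  then have "\<gamma> p \<noteq> 0" "\<gamma> p \<noteq> 1" using st g\<gamma>(2) kz by (metis atLeastAtMost_iff not_less)+
  moreover have "\<gamma> (g1 t) = t" if "t \<in> {0..1}" for t
    using arc that unfolding \<gamma>_def arc_def by (simp add: the_inv_into_f_f)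
  then have "\<gamma> (g1 0) = 0" "\<gamma> (g1 1) = 1" by simp_all
  ultimately have "p \<noteq> g1 0" "p \<noteq> g1 1" by metis+
  then show "p \<in> arc_interior g1"
    using p1 by (simp add: arc_interior_def pathstart_def pathfinish_def)
qed

text \<open>
  The abscissa is injective on the arc, which is compact, so the inverse of this projection is
  continuous. Along the parameter the abscissa is monotone, so its extreme values are at the end points.
\<close>

lemma x_monotone_arc_is_graph:
  assumes arc: "arc g" and mono: "x_monotone g" and ends: "{pathstart g, pathfinish g} = {a, b}"
  obtains f where "continuous_on (closed_segment (fst a) (fst b)) f"
    "path_image g = (\<lambda>x. (x, f x)) ` closed_segment (fst a) (fst b)" "fst a \<noteq> fst b"
proof -
  have injA: "inj_on fst (path_image g)"
    using mono unfolding x_monotone_def inj_on_def by blast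
  have cg: "continuous_on {0..1} (\<lambda>t. fst (g t))"
    using arc by (auto simp: arc_def path_def intro!: continuous_intros)
  have ig: "inj_on (\<lambda>t. fst (g t)) {0..1}"
    using comp_inj_on[of g "{0..1}" fst] arc injA by (simp add: arc_def path_image_def o_def)
  have ne: "fst (g 0) \<noteq> fst (g 1)" using inj_onD[OF ig, of 0 1] by auto
  have seg: "closed_segment (fst (g 0)) (fst (g 1)) = closed_segment (fst a) (fst b)"
    using ends by (auto simp: pathstart_def pathfinish_def doubleton_eq_iff closed_segment_commute)
  have nab: "fst a \<noteq> fst b"
    using ends ne by (auto simp: pathstart_def pathfinish_def doubleton_eq_iff)
  have proj: "fst ` path_image g = closed_segment (fst a) (fst b)"
  proof
    show "fst ` path_image g \<subseteq> closed_segment (fst a) (fst b)"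
    proof clarify
      fix x y assume "(x, y) \<in> path_image g"
      then obtain t where t: "t \<in> {0..1}" "g t = (x, y)" unfolding path_image_def by force
      have "x \<in> closed_segment (fst (g 0)) (fst (g 1))"
      proof (cases "t = 0 \<or> t = 1")
        case True then show ?thesis using t by auto
      next
        case False
        then have "0 < t" "t < 1" using t by auto
        from continuous_inj_imp_mono[OF this cg ig] show ?thesis
          using t by (auto simp: closed_segment_eq_real_ivl)
      qed
      then show "fst (x, y) \<in> closed_segment (fst a) (fst b)" by (simp add: seg)
    qed
    have "connected (fst ` path_image g)"
      using arc by (intro connected_continuous_image continuous_intros)
        (simp_all add: arc_imp_path connected_path_image)
    then have "convex (fst ` path_image g)" by (simp add: connected_convex_1)
    moreover have "fst a \<in> fst ` path_image g" "fst b \<in> fst ` path_image g"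
      using ends by (metis imageI insertCI insertE pathfinish_in_path_image pathstart_in_path_image singletonD)+
    ultimately show "closed_segment (fst a) (fst b) \<subseteq> fst ` path_image g"
      by (metis closed_segment_subset)
  qed
  define \<sigma> where "\<sigma> = the_inv_into (path_image g) fst"
  have "continuous_on (fst ` path_image g) \<sigma>"
    unfolding \<sigma>_def using arc injA
    by (intro continuous_on_inv_into continuous_intros) (simp_all add: compact_arc_image arc_imp_path compact_path_image)
  then have c: "continuous_on (closed_segment (fst a) (fst b)) (\<lambda>x. snd (\<sigma> x))"
    by (intro continuous_intros) (simp add: proj)
  have \<sigma>f: "\<sigma> (fst p) = p" if "p \<in> path_image g" for p
    using that injA by (simp add: \<sigma>_def the_inv_into_f_f)
  have "path_image g = (\<lambda>x. (x, snd (\<sigma> x))) ` closed_segment (fst a) (fst b)"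
    unfolding proj[symmetric] image_image using \<sigma>f by (auto simp flip: prod_eq_iff)
  then show thesis using that c nab by blast
qed

section \<open>The upper bound\<close>

text \<open>
  Some two edges of the path cross. Adjacent edges have their only common point at the common end, where
  no crossing is possible, so the first and the last edge cross.
\<close>

lemma path3_meets:
  assumes lt: "local_thrackle G" and p3: "path3 G a b c d"
  shows "path_image (curve G {a, b}) \<inter> path_image (curve G {c, d}) \<noteq> {}"
proof -
  have simple: "simple_topological_graph G" using lt by (simp add: local_thrackle_def)
  then have top: "topological_graph G" by (simp add: simple_topological_graph_def)
  have dist: "distinct [a, b, c, d]" and E: "{a, b} \<in> edges G" "{b, c} \<in> edges G" "{c, d} \<in> edges G"
    using p3 by (auto simp: path3_def)
  from lt p3 obtain e f where ef: "e \<in> {{a, b}, {b, c}, {c, d}}" "f \<in> {{a, b}, {b, c}, {c, d}}" "e \<noteq> f"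
    and "arcs_cross (curve G e) (curve G f)"
    unfolding local_thrackle_def plane_path3_def by blast
  then obtain p where cross: "properly_cross_at p (curve G e) (curve G f)"
    unfolding arcs_cross_def by blast
  have eE: "e \<in> edges G" "f \<in> edges G" using ef(1,2) E by auto
  have arc: "arc (curve G g)" "{pathstart (curve G g), pathfinish (curve G g)} = g" if "g \<in> edges G" for g
    using top that by (simp_all add: topological_graph_def)
  have p: "p \<in> path_image (curve G e)" "p \<in> path_image (curve G f)" "p \<notin> e"
    using properly_cross_at_interior[OF cross arc(1)[OF eE(1)]] arc(2)[OF eE(1)]
    by (auto simp: arc_interior_def)
  have verts_on: "v \<in> path_image (curve G g)" if "g \<in> edges G" "v \<in> g" for v g
    using arc(2)[OF that(1)] that(2) pathstart_in_path_image pathfinish_in_path_image by (metis insertE singletonD)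
  have "e \<inter> f = {}"
  proof (rule ccontr)
    assume "e \<inter> f \<noteq> {}"
    then obtain v where v: "v \<in> e" "v \<in> f" by blast
    then have "p = v" using simple eE ef(3) p(1,2) verts_on
      unfolding simple_topological_graph_def by blast
    then show False using p(3) v by simp
  qed
  then have disj: "x \<notin> f" if "x \<in> e" for x using that by blast
  consider "e = {a, b}" "f = {c, d}" | "e = {c, d}" "f = {a, b}"
    using ef disj[of a] disj[of b] disj[of c] disj[of d] unfolding insert_iff by fast
  then show ?thesis using p(1,2) by cases blast+
qed

locale monotone_local_thrackle =
  fixes G :: topgraph
  assumes thrackle: "local_thrackle G" and monotone: "x_monotone_edges G"
begin

abbreviation "V \<equiv> verts G"
abbreviation "E \<equiv> edges G"

text \<open>
  The function whose graph is the edge \<open>{a, b}\<close>. Its domain is written as a segment, so that nothing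
  depends on which of the two ends is on the left.
\<close>

definition ht :: "plane \<Rightarrow> plane \<Rightarrow> real \<Rightarrow> real" where
  "ht a b = (SOME f. continuous_on (closed_segment (fst a) (fst b)) f \<and>
     path_image (curve G {a, b}) = (\<lambda>x. (x, f x)) ` closed_segment (fst a) (fst b))"

lemma simple: "simple_topological_graph G"
  using thrackle by (simp add: local_thrackle_def)

lemma topological: "topological_graph G"
  using simple by (simp add: simple_topological_graph_def)

lemma edges_meet_once:
  assumes "e \<in> E" "f \<in> E" "e \<noteq> f"
    and "p \<in> path_image (curve G e)" "p \<in> path_image (curve G f)"
    and "q \<in> path_image (curve G e)" "q \<in> path_image (curve G f)"
  shows "p = q"
  using simple assms unfolding simple_topological_graph_def by blast

lemma finite_V: "finite V"
  using topological by (simp add: topological_graph_def)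

lemma edge_ends: "{a, b} \<in> E \<Longrightarrow> a \<in> V \<and> b \<in> V \<and> a \<noteq> b"
  using topological by (force simp: topological_graph_def)

lemma ht_commute: "ht a b = ht b a"
  unfolding ht_def by (simp add: insert_commute closed_segment_commute)

lemma
  assumes "{a, b} \<in> E"
  shows continuous_ht: "continuous_on (closed_segment (fst a) (fst b)) (ht a b)"
    and on_edge_iff: "p \<in> path_image (curve G {a, b}) \<longleftrightarrow>
      fst p \<in> closed_segment (fst a) (fst b) \<and> snd p = ht a b (fst p)"
    and fst_neq: "fst a \<noteq> fst b"
proof -
  let ?P = "\<lambda>f. continuous_on (closed_segment (fst a) (fst b)) f \<and>
     path_image (curve G {a, b}) = (\<lambda>x. (x, f x)) ` closed_segment (fst a) (fst b)"
  have "arc (curve G {a, b})" "{pathstart (curve G {a, b}), pathfinish (curve G {a, b})} = {a, b}"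
    using topological assms by (simp_all add: topological_graph_def)
  moreover have "x_monotone (curve G {a, b})"
    using monotone assms by (simp add: x_monotone_edges_def)
  ultimately obtain f where "?P f" and ne: "fst a \<noteq> fst b"
    using x_monotone_arc_is_graph by metis
  from \<open>?P f\<close> have P: "?P (ht a b)" unfolding ht_def by (rule someI[of ?P])
  then show "continuous_on (closed_segment (fst a) (fst b)) (ht a b)" by blast
  show "p \<in> path_image (curve G {a, b}) \<longleftrightarrow>
      fst p \<in> closed_segment (fst a) (fst b) \<and> snd p = ht a b (fst p)"
    using P by (auto simp: image_iff prod_eq_iff)
  show "fst a \<noteq> fst b" by (rule ne)
qed

lemma ht_ends:
  assumes "{a, b} \<in> E"
  shows "ht a b (fst a) = snd a" "ht a b (fst b) = snd b"
proof -
  have "{pathstart (curve G {a, b}), pathfinish (curve G {a, b})} = {a, b}"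
    using topological assms by (simp add: topological_graph_def)
  then have "a \<in> path_image (curve G {a, b})" "b \<in> path_image (curve G {a, b})"
    by (metis insertCI insertE pathfinish_in_path_image pathstart_in_path_image singletonD)+
  then show "ht a b (fst a) = snd a" "ht a b (fst b) = snd b"
    using assms by (simp_all add: on_edge_iff)
qed

lemma vertex_on_edge:
  assumes "{a, b} \<in> E" "v \<in> V" "fst v \<in> closed_segment (fst a) (fst b)" "ht a b (fst v) = snd v"
  shows "v \<in> {a, b}"
proof -
  have "v \<in> path_image (curve G {a, b})" using assms by (simp add: on_edge_iff)
  then show ?thesis using topological assms(1,2) unfolding topological_graph_def by blast
qed

lemma path3_common_height:
  assumes "{a, b} \<in> E" "{b, c} \<in> E" "{c, d} \<in> E" "distinct [a, b, c, d]"
  obtains x where "x \<in> closed_segment (fst a) (fst b)" "x \<in> closed_segment (fst c) (fst d)"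
    "ht a b x = ht c d x"
proof -
  have "path_image (curve G {a, b}) \<inter> path_image (curve G {c, d}) \<noteq> {}"
    using thrackle assms by (intro path3_meets) (auto simp: path3_def)
  then obtain p where "p \<in> path_image (curve G {a, b})" "p \<in> path_image (curve G {c, d})" by blast
  then show thesis using that[of "fst p"] assms(1,3) by (simp add: on_edge_iff)
qed

text \<open>
  The abscissae over which both edges \<open>va\<close> and \<open>vc\<close> extend, apart from that of \<open>v\<close>: an interval next
  to that of \<open>v\<close> if \<open>a\<close> and \<open>c\<close> are on the same side of \<open>v\<close>, and empty otherwise.
\<close>

definition shared :: "plane \<Rightarrow> plane \<Rightarrow> plane \<Rightarrow> real set" where
  "shared v a c = (closed_segment (fst v) (fst a) \<inter> closed_segment (fst v) (fst c)) - {fst v}"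

definition above :: "plane \<Rightarrow> plane \<Rightarrow> plane \<Rightarrow> bool" where
  "above v a c \<longleftrightarrow> (\<forall>x \<in> shared v a c. ht v c x < ht v a x)"

lemma shared_commute: "shared v a c = shared v c a"
  by (auto simp: shared_def)

text \<open>
  Otherwise the intermediate value theorem gives a second common point of the two edges, besides \<open>v\<close>.
\<close>

lemma above_total:
  assumes "{v, a} \<in> E" "{v, c} \<in> E" "a \<noteq> c"
  shows "above v a c \<or> above v c a"
proof (rule ccontr)
  let ?S = "shared v a c"
  let ?d = "\<lambda>x. ht v a x - ht v c x"
  assume "\<not> ?thesis"
  then have "\<not> above v a c" "\<not> above v c a" by simp_all
  then obtain x y where "x \<in> ?S" "y \<in> ?S" "\<not> ht v c x < ht v a x" "\<not> ht v a y < ht v c y"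
    unfolding above_def shared_commute[of v c a] by meson
  then have xy: "x \<in> ?S" "y \<in> ?S" "?d x \<le> 0" "0 \<le> ?d y" by simp_all
  have conv: "{min x y..max x y} \<subseteq> ?S"
  proof (intro subsetI)
    fix z assume "z \<in> {min x y..max x y}"
    then have "x \<le> z \<and> z \<le> y \<or> y \<le> z \<and> z \<le> x" by (auto simp: min_def max_def split: if_splits)
    then show "z \<in> ?S"
      using xy(1,2) by (auto simp: shared_def closed_segment_eq_real_ivl split: if_splits)
  qed
  have cont: "continuous_on {min x y..max x y} ?d"
    using conv unfolding shared_def
    by (intro continuous_on_diff continuous_on_subset[OF continuous_ht] assms(1,2)) auto
  have "\<exists>z\<in>{min x y..max x y}. ?d z = 0"
  proof (cases "x \<le> y")
    case True
    then show ?thesis using IVT'[of ?d x 0 y] xy(3,4) cont by auto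
  next
    case False
    then show ?thesis using IVT2'[of ?d x 0 y] xy(3,4) cont by auto
  qed
  then obtain z where z: "z \<in> ?S" "ht v a z = ht v c z" using conv by auto
  have ne: "{v, a} \<noteq> {v, c}" using assms(3) by (auto simp: doubleton_eq_iff)
  have "(z, ht v a z) = v"
  proof (rule edges_meet_once[OF assms(1,2) ne])
    show "(z, ht v a z) \<in> path_image (curve G {v, a})" "(z, ht v a z) \<in> path_image (curve G {v, c})"
      using z assms unfolding shared_def by (simp_all add: on_edge_iff)
    show "v \<in> path_image (curve G {v, a})" "v \<in> path_image (curve G {v, c})"
      using assms by (simp_all add: on_edge_iff ht_ends)
  qed
  moreover have "z \<noteq> fst v" using z(1) by (simp add: shared_def)
  ultimately show False by (metis fst_conv)
qed

text \<open>
  Over the common range of \<open>ab\<close> and \<open>cd\<close> the edge \<open>bc\<close> runs below \<open>ab\<close> and above \<open>cd\<close>, so that the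
  path \<open>abcd\<close> would be plane. The vertices \<open>a\<close> and \<open>d\<close> are distinct because they are on different
  sides of \<open>bc\<close>.
\<close>

lemma not_above_and_below:
  assumes E: "{b, c} \<in> E" "{b, a} \<in> E" "{c, d} \<in> E" and bc: "fst b < fst c"
    and a: "fst b < fst a" "a \<noteq> c" "above b a c" and d: "fst d < fst c" "d \<noteq> b" "above c b d"
  shows False
proof -
  have ad: "a \<noteq> d"
  proof
    assume "a = d"
    then have "fst a \<in> shared b a c" "fst a \<in> shared c b d"
      using a(1) d(1) bc by (auto simp: shared_def closed_segment_eq_real_ivl)
    then have "ht b c (fst a) < snd a" "snd a < ht c b (fst a)"
      using a(3) d(3) E ht_ends \<open>a = d\<close> unfolding above_def by metis+
    then show False using ht_commute[of c b] by simp
  qed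
  have ne: "a \<noteq> b" "b \<noteq> c" "c \<noteq> d" using E edge_ends by blast+
  obtain x where x: "x \<in> closed_segment (fst a) (fst b)" "x \<in> closed_segment (fst c) (fst d)"
    "ht a b x = ht c d x"
    using path3_common_height[of a b c d] E ad ne a(2) d(2) by (auto simp: insert_commute)
  have "x \<noteq> fst b"
  proof
    assume "x = fst b"
    then have "b \<in> {c, d}" using vertex_on_edge[of c d b] x E edge_ends ht_ends ht_commute by metis
    then show False using ne d(2) by auto
  qed
  moreover have "x \<noteq> fst c"
  proof
    assume "x = fst c"
    then have "c \<in> {b, a}" using vertex_on_edge[of b a c] x E edge_ends ht_ends ht_commute
      by (metis closed_segment_commute)
    then show False using ne a(2) by auto
  qed
  ultimately have "x \<in> shared b a c" "x \<in> shared c b d"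
    using x(1,2) a(1) d(1) bc by (auto simp: shared_def closed_segment_eq_real_ivl split: if_splits)
  then have "ht b c x < ht b a x" "ht c d x < ht c b x"
    using a(3) d(3) by (auto simp: above_def)
  then show False using x(3) ht_commute[of a b] ht_commute[of c b] by (metis less_asym)
qed

definition with_right_edge :: "plane set" where
  "with_right_edge = {v. \<exists>w. {v, w} \<in> E \<and> fst v < fst w}"

definition with_left_edge :: "plane set" where
  "with_left_edge = {v. \<exists>w. {w, v} \<in> E \<and> fst w < fst v}"

lemma finite_with_right_edge: "finite with_right_edge" and finite_with_left_edge: "finite with_left_edge"
  and with_right_edge_subset: "with_right_edge \<subseteq> V" and with_left_edge_subset: "with_left_edge \<subseteq> V"
proof -
  show sub: "with_right_edge \<subseteq> V"
  proof
    fix v assume "v \<in> with_right_edge"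
    then obtain w where "{v, w} \<in> E" unfolding with_right_edge_def by blast
    then show "v \<in> V" using edge_ends[of v w] by simp
  qed
  show sub': "with_left_edge \<subseteq> V"
  proof
    fix v assume "v \<in> with_left_edge"
    then obtain w where "{w, v} \<in> E" unfolding with_left_edge_def by blast
    then show "v \<in> V" using edge_ends[of w v] by simp
  qed
  show "finite with_right_edge" "finite with_left_edge"
    using finite_subset[OF sub finite_V] finite_subset[OF sub' finite_V] by simp_all
qed

text \<open>
  With \<open>D\<close> the set of the edges directed from left to right, \<open>T\<close> consists of the edges that are
  topmost at their left end and \<open>B\<close> of those that are lowest at their right end. By
  \<open>not_above_and_below\<close> these cover \<open>D\<close>, and by \<open>above_total\<close> an edge in \<open>T\<close> is determined by its left
  end and an edge in \<open>B\<close> by its right end.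
\<close>

lemma card_E_le: "card E \<le> card with_right_edge + card with_left_edge"
proof -
  define D where "D = {(b, c). {b, c} \<in> E \<and> fst b < fst c}"
  define T where "T = {p \<in> D. \<forall>q \<in> D. fst q = fst p \<and> q \<noteq> p \<longrightarrow> \<not> above (fst p) (snd q) (snd p)}"
  define B where "B = {p \<in> D. \<forall>q \<in> D. snd q = snd p \<and> q \<noteq> p \<longrightarrow> \<not> above (snd p) (fst p) (fst q)}"
  have DE: "{fst p, snd p} \<in> E" "{snd p, fst p} \<in> E" "fst (fst p) < fst (snd p)" if "p \<in> D" for p
    using that unfolding D_def by (simp_all add: case_prod_beta insert_commute)
  have D: "D = T \<union> B"
  proof
    show "D \<subseteq> T \<union> B"
    proof
      fix p assume p: "p \<in> D"
      show "p \<in> T \<union> B"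
      proof (rule ccontr)
        assume "p \<notin> T \<union> B"
        then obtain q r where q: "q \<in> D" "fst q = fst p" "q \<noteq> p" "above (fst p) (snd q) (snd p)"
          and r: "r \<in> D" "snd r = snd p" "r \<noteq> p" "above (snd p) (fst p) (fst r)"
          using p unfolding T_def B_def by blast
        show False
        proof (rule not_above_and_below)
          show "{fst p, snd p} \<in> E" "fst (fst p) < fst (snd p)" using DE[OF p] by simp_all
          show "{fst p, snd q} \<in> E" "fst (fst p) < fst (snd q)" using DE[OF q(1)] q(2) by simp_all
          show "{snd p, fst r} \<in> E" "fst (fst r) < fst (snd p)" using DE[OF r(1)] r(2) by simp_all
          show "snd q \<noteq> snd p" using q(2,3) by (auto simp: prod_eq_iff)
          show "fst r \<noteq> fst p" using r(2,3) by (auto simp: prod_eq_iff)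
        qed (use q(4) r(4) in simp_all)
      qed
    qed
    show "T \<union> B \<subseteq> D" unfolding T_def B_def by blast
  qed
  have "p \<in> V \<times> V" if "p \<in> D" for p
    using that edge_ends[of "fst p" "snd p"] unfolding D_def by (simp add: case_prod_beta mem_Times_iff)
  then have "D \<subseteq> V \<times> V" by blast
  then have "finite D" using finite_V by (meson finite_SigmaI finite_subset)
  have "inj_on fst T"
  proof (rule inj_onI, rule ccontr)
    fix p q assume T: "p \<in> T" "q \<in> T" and eq: "fst p = fst q" and ne: "p \<noteq> q"
    have "p \<in> D" "q \<in> D" using T by (simp_all add: D)
    then have "{fst p, snd p} \<in> E" "{fst p, snd q} \<in> E" using DE(1) eq by metis+
    moreover have "snd p \<noteq> snd q" using eq ne by (auto simp: prod_eq_iff)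
    ultimately have "above (fst p) (snd p) (snd q) \<or> above (fst p) (snd q) (snd p)"
      by (rule above_total)
    moreover have "\<not> above (fst p) (snd q) (snd p)"
      using T(1) \<open>q \<in> D\<close> eq[symmetric] ne unfolding T_def by blast
    moreover have "\<not> above (fst q) (snd p) (snd q)"
      using T(2) \<open>p \<in> D\<close> eq ne unfolding T_def by blast
    ultimately show False unfolding eq by blast
  qed
  moreover have "fst ` T \<subseteq> with_right_edge"
  proof (rule image_subsetI)
    fix p assume "p \<in> T"
    then have "p \<in> D" by (simp add: D)
    from DE[OF this] show "fst p \<in> with_right_edge" unfolding with_right_edge_def by blast
  qed
  ultimately have T: "card T \<le> card with_right_edge" using finite_with_right_edge by (rule card_inj_on_le)
  have "inj_on snd B"
  proof (rule inj_onI, rule ccontr)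
    fix p q assume B: "p \<in> B" "q \<in> B" and eq: "snd p = snd q" and ne: "p \<noteq> q"
    have "p \<in> D" "q \<in> D" using B by (simp_all add: D)
    then have "{snd p, fst p} \<in> E" "{snd p, fst q} \<in> E" using DE(2) eq by metis+
    moreover have "fst p \<noteq> fst q" using eq ne by (auto simp: prod_eq_iff)
    ultimately have "above (snd p) (fst p) (fst q) \<or> above (snd p) (fst q) (fst p)"
      by (rule above_total)
    moreover have "\<not> above (snd p) (fst p) (fst q)"
      using B(1) \<open>q \<in> D\<close> eq[symmetric] ne unfolding B_def by blast
    moreover have "\<not> above (snd q) (fst q) (fst p)"
      using B(2) \<open>p \<in> D\<close> eq ne unfolding B_def by blast
    ultimately show False unfolding eq by blast
  qed
  moreover have "snd ` B \<subseteq> with_left_edge"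
  proof (rule image_subsetI)
    fix p assume "p \<in> B"
    then have "p \<in> D" by (simp add: D)
    from DE[OF this] show "snd p \<in> with_left_edge" unfolding with_left_edge_def by blast
  qed
  ultimately have B: "card B \<le> card with_left_edge" using finite_with_left_edge by (rule card_inj_on_le)
  have "E \<subseteq> (\<lambda>p. {fst p, snd p}) ` D"
  proof
    fix e assume e: "e \<in> E"
    then have "card e = 2" using topological by (simp add: topological_graph_def)
    then obtain b c where bc: "e = {b, c}" by (meson card_2_iff)
    have "{b, c} \<in> E" "{c, b} \<in> E" using e bc by (simp_all add: insert_commute)
    then have "(b, c) \<in> D \<or> (c, b) \<in> D" using fst_neq[of b c] unfolding D_def by (simp add: neq_iff)
    then show "e \<in> (\<lambda>p. {fst p, snd p}) ` D"
    proof
      assume "(b, c) \<in> D"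
      then show ?thesis by (rule image_eqI[rotated]) (simp add: bc)
    next
      assume "(c, b) \<in> D"
      then show ?thesis by (rule image_eqI[rotated]) (simp add: bc insert_commute)
    qed
  qed
  with \<open>finite D\<close> have "card E \<le> card D" by (rule surj_card_le)
  also have "card D \<le> card T + card B" unfolding D by (rule card_Un_le)
  finally show ?thesis using T B by linarith
qed

text \<open>
  With a further edge \<open>ab\<close> from the left, the edges \<open>ab\<close> and \<open>md\<close> of the path \<open>abmd\<close> would be on
  different sides of the strip spanned by \<open>bm\<close>.
\<close>

lemma neighbour_left:
  assumes m: "{b, m} \<in> E" "fst b < fst m" and d: "{m, d} \<in> E" "fst m < fst d"
  shows "b \<notin> with_left_edge"
proof
  assume "b \<in> with_left_edge"
  then obtain a where a: "{a, b} \<in> E" "fst a < fst b" by (auto simp: with_left_edge_def)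
  obtain x where "x \<in> closed_segment (fst a) (fst b)" "x \<in> closed_segment (fst m) (fst d)"
    by (rule path3_common_height[of a b m d]) (use a m d in auto)
  then show False using a m d by (auto simp: closed_segment_eq_real_ivl)
qed

lemma neighbour_right:
  assumes m: "{b, m} \<in> E" "fst b < fst m" and d: "{m, d} \<in> E" "fst m < fst d"
  shows "d \<notin> with_right_edge"
proof
  assume "d \<in> with_right_edge"
  then obtain a where a: "{d, a} \<in> E" "fst d < fst a" by (auto simp: with_right_edge_def)
  obtain x where "x \<in> closed_segment (fst b) (fst m)" "x \<in> closed_segment (fst d) (fst a)"
    by (rule path3_common_height[of b m d a]) (use a m d in auto)
  then show False using a m d by (auto simp: closed_segment_eq_real_ivl)
qed

text \<open>
  Of two neighbours \<open>m\<close> and \<open>m'\<close> on the same side of \<open>v\<close>, one that is at least as far from \<open>v\<close> as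
  the other has no edge that leads still farther away: in the path \<open>m' v m w\<close> the first and the last edge would have disjoint
  ranges, or ranges that touch at the distinct points \<open>m\<close> and \<open>m'\<close> of the same abscissa.
\<close>

lemma disjoint_stars:
  assumes "{v, m} \<in> E" "{v, m'} \<in> E" "{m, w} \<in> E" "m \<noteq> m'"
    and "fst v < fst m' \<and> fst m' \<le> fst m \<and> fst m < fst w \<or>
         fst w < fst m \<and> fst m \<le> fst m' \<and> fst m' < fst v"
  shows False
proof -
  have "m' \<noteq> v" "v \<noteq> m" "m' \<noteq> w" "v \<noteq> w" using assms by auto
  then obtain x where x: "x \<in> closed_segment (fst m') (fst v)" "x \<in> closed_segment (fst m) (fst w)"
    "ht m' v x = ht m w x"
    using assms path3_common_height[of m' v m w] by (auto simp: insert_commute)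
  then have "x = fst m'" "x = fst m" using assms by (auto simp: closed_segment_eq_real_ivl)
  then have "m' = m" using x(3) assms ht_ends ht_commute by (metis insert_commute prod_eqI)
  then show False using assms(4) by simp
qed

text \<open>
  A choice of left neighbours \<open>l\<close> and of right neighbours \<open>r\<close> maps the set \<open>M\<close> of two-sided vertices
  injectively into the vertices with edges to the right only and into those with edges to the left only.
\<close>

lemma edges_le: "3 * card E \<le> 4 * card V"
proof -
  define M where "M = with_right_edge \<inter> with_left_edge"
  have "\<exists>b. {b, m} \<in> E \<and> fst b < fst m" "\<exists>d. {m, d} \<in> E \<and> fst m < fst d" if "m \<in> M" for m
    using that unfolding M_def with_right_edge_def with_left_edge_def by blast+
  then obtain l r where l: "\<And>m. m \<in> M \<Longrightarrow> {l m, m} \<in> E \<and> fst (l m) < fst m"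
    and r: "\<And>m. m \<in> M \<Longrightarrow> {m, r m} \<in> E \<and> fst m < fst (r m)" by metis
  have "inj_on l M"
  proof (rule inj_onI, rule ccontr)
    fix m m' assume m: "m \<in> M" "m' \<in> M" and eq: "l m = l m'" and ne: "m \<noteq> m'"
    show False
    proof (cases "fst m' \<le> fst m")
      case True
      show False
        by (rule disjoint_stars[of "l m" m m' "r m"])
          (use True l[OF m(1)] l[OF m(2)] r[OF m(1)] eq ne in simp_all)
    next
      case False
      show False
        by (rule disjoint_stars[of "l m'" m' m "r m'"])
          (use False l[OF m(1)] l[OF m(2)] r[OF m(2)] eq ne in simp_all)
    qed
  qed
  moreover have "l ` M \<subseteq> with_right_edge - M"
  proof (rule image_subsetI)
    fix m assume m: "m \<in> M"
    have "l m \<in> with_right_edge" using l[OF m] unfolding with_right_edge_def by blast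
    moreover have "l m \<notin> with_left_edge" using neighbour_left[of "l m" m "r m"] l[OF m] r[OF m] by blast
    ultimately show "l m \<in> with_right_edge - M" unfolding M_def by blast
  qed
  ultimately have L: "card M \<le> card (with_right_edge - M)" using finite_with_right_edge by (intro card_inj_on_le[of l]) simp_all
  have "inj_on r M"
  proof (rule inj_onI, rule ccontr)
    fix m m' assume m: "m \<in> M" "m' \<in> M" and eq: "r m = r m'" and ne: "m \<noteq> m'"
    show False
    proof (cases "fst m' \<le> fst m")
      case False
      show False
        by (rule disjoint_stars[of "r m" m m' "l m"])
          (use False r[OF m(1)] r[OF m(2)] l[OF m(1)] eq ne in \<open>simp_all add: insert_commute\<close>)
    next
      case True
      show False
        by (rule disjoint_stars[of "r m'" m' m "l m'"])
          (use True r[OF m(1)] r[OF m(2)] l[OF m(2)] eq ne in \<open>simp_all add: insert_commute\<close>)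
    qed
  qed
  moreover have "r ` M \<subseteq> with_left_edge - M"
  proof (rule image_subsetI)
    fix m assume m: "m \<in> M"
    have "r m \<in> with_left_edge" using r[OF m] unfolding with_left_edge_def by blast
    moreover have "r m \<notin> with_right_edge" using neighbour_right[of "l m" m "r m"] l[OF m] r[OF m] by blast
    ultimately show "r m \<in> with_left_edge - M" unfolding M_def by blast
  qed
  ultimately have R: "card M \<le> card (with_left_edge - M)" using finite_with_left_edge by (intro card_inj_on_le[of r]) simp_all
  have fM: "finite M" using finite_with_right_edge by (simp add: M_def)
  have un: "with_right_edge = M \<union> (with_right_edge - M)" "with_left_edge = M \<union> (with_left_edge - M)" by (auto simp: M_def)
  have eq: "card with_right_edge = card M + card (with_right_edge - M)" "card with_left_edge = card M + card (with_left_edge - M)"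
    using fM finite_with_right_edge finite_with_left_edge
    by (subst un, subst card_Un_disjoint, blast+)+
  have disj: "(with_right_edge - M) \<inter> (with_left_edge - M) = {}" by (auto simp: M_def)
  have "card M + (card (with_right_edge - M) + card (with_left_edge - M)) = card (M \<union> ((with_right_edge - M) \<union> (with_left_edge - M)))"
    using finite_with_right_edge finite_with_left_edge fM disj by (subst card_Un_disjoint; auto simp: card_Un_disjoint)
  also have "\<dots> \<le> card V" using finite_V with_right_edge_subset with_left_edge_subset
    by (intro card_mono) (auto simp: M_def)
  finally show ?thesis using L R eq card_E_le by linarith
qed

end

section \<open>Proper crossings of piecewise linear curves\<close>

text \<open>
  Near the point both arcs are straight lines of different slopes, and the two linear forms that vanish
  on these lines are the required coordinates. The scaling factor \<open>r\<close> keeps the preimage of the unit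
  disc within the strip of half width \<open>d\<close> in which the arcs are known.
\<close>

lemma properly_cross_at_if_locally_linear:
  assumes d: "d > 0" and ab: "\<alpha> \<noteq> \<beta>"
    and f: "\<And>x y. \<bar>x - x0\<bar> < d \<Longrightarrow> (x, y) \<in> path_image g1 \<longleftrightarrow> y = y0 + \<alpha> * (x - x0)"
    and g: "\<And>x y. \<bar>x - x0\<bar> < d \<Longrightarrow> (x, y) \<in> path_image g2 \<longleftrightarrow> y = y0 + \<beta> * (x - x0)"
  shows "properly_cross_at (x0, y0) g1 g2"
proof -
  define r where "r = d * \<bar>\<alpha> - \<beta>\<bar> / 2"
  have r: "r > 0" using d ab by (simp add: r_def)
  define h :: "plane \<Rightarrow> plane" where
    "h = (\<lambda>z. ((snd z - y0 - \<beta> * (fst z - x0)) / r, (snd z - y0 - \<alpha> * (fst z - x0)) / r))"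
  define k :: "plane \<Rightarrow> plane" where
    "k = (\<lambda>w. (x0 + r * (fst w - snd w) / (\<alpha> - \<beta>),
               y0 + r * snd w + \<alpha> * (r * (fst w - snd w) / (\<alpha> - \<beta>))))"
  have hk: "h (k w) = w" for w
  proof -
    define q where "q = r * (fst w - snd w) / (\<alpha> - \<beta>)"
    have "(\<alpha> - \<beta>) * q = r * (fst w - snd w)" using ab by (simp add: q_def)
    then have "r * snd w + \<alpha> * q - \<beta> * q = r * fst w" by (simp add: algebra_simps)
    moreover have "k w = (x0 + q, y0 + r * snd w + \<alpha> * q)" by (simp add: k_def q_def)
    ultimately show ?thesis using r by (simp add: h_def prod_eq_iff)
  qed
  have kh: "k (h z) = z" for z
  proof -
    have "fst (h z) - snd (h z) = (\<alpha> - \<beta>) * (fst z - x0) / r"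
      by (simp add: h_def diff_divide_distrib[symmetric] algebra_simps)
    then have "r * (fst (h z) - snd (h z)) / (\<alpha> - \<beta>) = fst z - x0" using r ab by simp
    moreover have "r * snd (h z) = snd z - y0 - \<alpha> * (fst z - x0)" using r by (simp add: h_def)
    ultimately show ?thesis by (simp add: k_def prod_eq_iff del: times_divide_eq_right)
  qed
  define U where "U = h -` ball 0 1"
  have ch: "continuous_on S h" for S unfolding h_def by (intro continuous_intros) (use r in auto)
  have ck: "continuous_on S k" for S unfolding k_def by (intro continuous_intros) (use ab in auto)
  have hp: "h (x0, y0) = 0" by (simp add: h_def zero_prod_def)
  have near: "\<bar>fst (k w) - x0\<bar> < d" if "w \<in> ball 0 1" for w
  proof -
    have "\<bar>fst w\<bar> < 1" "\<bar>snd w\<bar> < 1"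
      using that norm_snd_le[of "snd w" "fst w"] norm_fst_le[of "fst w" "snd w"] by auto
    then have "\<bar>fst w - snd w\<bar> < 2" by arith
    then have "r * \<bar>fst w - snd w\<bar> < r * 2" using r by simp
    also have "r * 2 = d * \<bar>\<alpha> - \<beta>\<bar>" by (simp add: r_def)
    finally show ?thesis using r ab by (simp add: k_def abs_mult pos_divide_less_eq)
  qed
  have U: "U = k ` ball 0 1"
  proof
    show "U \<subseteq> k ` ball 0 1" unfolding U_def by (metis kh imageI subsetI vimageE)
    show "k ` ball 0 1 \<subseteq> U" unfolding U_def using hk by auto
  qed
  have im: "h ` (A \<inter> U) = {w \<in> ball 0 1. P w}" if "\<And>w. w \<in> ball 0 1 \<Longrightarrow> k w \<in> A \<longleftrightarrow> P w" for A P
  proof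
    show "h ` (A \<inter> U) \<subseteq> {w \<in> ball 0 1. P w}"
    proof
      fix w assume "w \<in> h ` (A \<inter> U)"
      then obtain z where z: "z \<in> A" "z \<in> U" "w = h z" by blast
      then have "w \<in> ball 0 1" unfolding U_def by blast
      moreover have "k w \<in> A" using z kh by simp
      ultimately show "w \<in> {w \<in> ball 0 1. P w}" using that by blast
    qed
    show "{w \<in> ball 0 1. P w} \<subseteq> h ` (A \<inter> U)"
    proof
      fix w assume "w \<in> {w \<in> ball 0 1. P w}"
      then have w: "w \<in> ball 0 1" "P w" by blast+
      then have "k w \<in> A \<inter> U" using that unfolding U by blast
      then have "h (k w) \<in> h ` (A \<inter> U)" by (rule imageI)
      then show "w \<in> h ` (A \<inter> U)" by (simp only: hk)
    qed
  qed
  have "open U" unfolding U_def using ch by (intro open_vimage) auto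
  moreover have "homeomorphism U (ball 0 1) h k"
    using hk kh ch ck by (intro homeomorphismI) (auto simp: U_def)
  moreover have "h ` (path_image g1 \<inter> U) = {w \<in> ball 0 1. snd w = 0}"
  proof (rule im)
    fix w :: plane assume w: "w \<in> ball 0 1"
    show "k w \<in> path_image g1 \<longleftrightarrow> snd w = 0"
      using f[OF near[OF w], of "snd (k w)"] r by (simp add: k_def)
  qed
  moreover have "h ` (path_image g2 \<inter> U) = {w \<in> ball 0 1. fst w = 0}"
  proof (rule im)
    fix w :: plane assume w: "w \<in> ball 0 1"
    have "fst (h (k w)) = (snd (k w) - y0 - \<beta> * (fst (k w) - x0)) / r" by (simp add: h_def)
    then have "snd (k w) = y0 + \<beta> * (fst (k w) - x0) \<longleftrightarrow> fst w = 0" using r hk by (auto simp: field_simps)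
    then show "k w \<in> path_image g2 \<longleftrightarrow> fst w = 0"
      using g[OF near[OF w], of "snd (k w)"] by simp
  qed
  moreover have "(x0, y0) \<in> U" by (simp add: U_def hp)
  ultimately show ?thesis unfolding properly_cross_at_def using hp by blast
qed

text \<open>
  Linear interpolation between the values \<open>H i, \<dots>, H j\<close> at \<open>i, \<dots>, j\<close>, as a sum of one clamped ramp for
  each unit interval. In this form continuity is immediate.
\<close>

definition interpol :: "(nat \<Rightarrow> real) \<Rightarrow> nat \<Rightarrow> nat \<Rightarrow> real \<Rightarrow> real" where
  "interpol H i j x = H i + (\<Sum>k=i..<j. (H (Suc k) - H k) * max 0 (min 1 (x - real k)))"

lemma continuous_interpol: "continuous_on S (interpol H i j)"
  unfolding interpol_def by (intro continuous_intros)

lemma interpol_Suc: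
  "i \<le> j \<Longrightarrow> interpol H i (Suc j) x = interpol H i j x + (H (Suc j) - H j) * max 0 (min 1 (x - real j))"
  by (simp add: interpol_def)

lemma interpol_right: "i \<le> j \<Longrightarrow> real j \<le> x \<Longrightarrow> interpol H i j x = H j"
proof (induction j rule: dec_induct)
  case base then show ?case by (simp add: interpol_def)
next
  case (step n) then show ?case by (simp add: interpol_Suc max_def min_def)
qed

lemma interpol_cell:
  "\<lbrakk>i \<le> k; k < j; real k \<le> x; x \<le> real (Suc k)\<rbrakk>
    \<Longrightarrow> interpol H i j x = H k + (x - real k) * (H (Suc k) - H k)"
proof (induction j)
  case (Suc j)
  show ?case
  proof (cases "k = j")
    case True
    then show ?thesis using Suc.prems by (simp add: interpol_Suc interpol_right max_def min_def)
  next
    case False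
    then have "real (Suc k) \<le> real j" using Suc.prems by (simp only: of_nat_le_iff)
    then show ?thesis using Suc False by (simp add: interpol_Suc)
  qed
qed simp

lemma interpol_nat: "\<lbrakk>i \<le> k; k \<le> j; i < j\<rbrakk> \<Longrightarrow> interpol H i j (real k) = H k"
  using interpol_cell[of i k j "real k" H] interpol_right[of i j "real k" H] by (cases "k = j") auto

section \<open>Zigzags\<close>

text \<open>
  A zigzag is given by the column of its left end and the list of its levels in this and the following
  columns. As only differences of columns enter, translation does not affect the list.
\<close>

type_synonym zigzag = "nat \<times> int list"

definition src :: "zigzag \<Rightarrow> nat" where "src e = fst e"

definition tgt :: "zigzag \<Rightarrow> nat" where "tgt e = fst e + length (snd e) - 1"

definition ends :: "zigzag \<Rightarrow> nat set" where "ends e = {src e, tgt e}"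

definition lev :: "zigzag \<Rightarrow> nat \<Rightarrow> int" where "lev e k = snd e ! (k - fst e)"

text \<open>
  In all columns that two zigzags share, the first is below the second. A common end is exempted, as
  both have level \<open>0\<close> there.
\<close>

definition below :: "zigzag \<Rightarrow> zigzag \<Rightarrow> bool" where
  "below e f \<longleftrightarrow> (\<forall>k \<in> {max (src e) (src f)..min (tgt e) (tgt f)}.
     k \<notin> ends e \<inter> ends f \<longrightarrow> lev e k < lev f k)"

text \<open>
  The first zigzag is below the second up to some shared column \<open>m\<close> and above it from the next column
  on.
\<close>

definition swap :: "zigzag \<Rightarrow> zigzag \<Rightarrow> bool" where
  "swap e f \<longleftrightarrow> (\<exists>m \<in> {max (src e) (src f)..<min (tgt e) (tgt f)}.
     (\<forall>k \<in> {max (src e) (src f)..m}. lev e k < lev f k) \<and>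
     (\<forall>k \<in> {Suc m..min (tgt e) (tgt f)}. lev f k < lev e k))"

text \<open>
  The vertices are the points of level \<open>0\<close>, so a zigzag runs between two of them and avoids all others.
\<close>

definition proper_zigzag :: "zigzag \<Rightarrow> bool" where
  "proper_zigzag e \<longleftrightarrow> 2 \<le> length (snd e) \<and>
     (\<forall>k \<in> {src e..tgt e}. lev e k = 0 \<longleftrightarrow> k \<in> ends e)"

definition height :: "zigzag \<Rightarrow> real \<Rightarrow> real" where
  "height e = interpol (\<lambda>k. of_int (lev e k)) (src e) (tgt e)"

definition zpath :: "zigzag \<Rightarrow> real \<Rightarrow> plane" where
  "zpath e t = (let x = real (src e) + t * (real (tgt e) - real (src e)) in (x, height e x))"

definition spine :: "nat \<Rightarrow> plane" where "spine k = (real k, 0)"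

lemma src_less_tgt: "proper_zigzag e \<Longrightarrow> src e < tgt e"
  by (auto simp: proper_zigzag_def src_def tgt_def)

lemma lev_ends: "proper_zigzag e \<Longrightarrow> k \<in> ends e \<Longrightarrow> lev e k = 0"
  using src_less_tgt[of e] by (auto simp: proper_zigzag_def ends_def)

lemma height_cell:
  "\<lbrakk>src e \<le> k; k < tgt e; real k \<le> x; x \<le> real (Suc k)\<rbrakk>
    \<Longrightarrow> height e x = of_int (lev e k) + (x - real k) * (of_int (lev e (Suc k)) - of_int (lev e k))"
  unfolding height_def by (rule interpol_cell)

lemma height_nat: "\<lbrakk>proper_zigzag e; src e \<le> k; k \<le> tgt e\<rbrakk> \<Longrightarrow> height e (real k) = of_int (lev e k)"
  unfolding height_def by (simp add: interpol_nat src_less_tgt)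

lemma zpath_image:
  assumes "proper_zigzag e"
  shows "(x, y) \<in> path_image (zpath e) \<longleftrightarrow> real (src e) \<le> x \<and> x \<le> real (tgt e) \<and> y = height e x"
proof
  have lt: "real (src e) < real (tgt e)" using src_less_tgt[OF assms] by simp
  show "(x, y) \<in> path_image (zpath e) \<Longrightarrow> real (src e) \<le> x \<and> x \<le> real (tgt e) \<and> y = height e x"
  proof -
    assume "(x, y) \<in> path_image (zpath e)"
    then obtain t where t: "0 \<le> t" "t \<le> 1" and xy: "zpath e t = (x, y)" unfolding path_image_def by auto
    have "0 \<le> t * (real (tgt e) - real (src e))" using t lt by simp
    moreover have "t * (real (tgt e) - real (src e)) \<le> real (tgt e) - real (src e)"
      using t lt mult_right_mono[of t 1 "real (tgt e) - real (src e)"] by simp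
    ultimately show ?thesis using xy by (auto simp: zpath_def Let_def)
  qed
  assume x: "real (src e) \<le> x \<and> x \<le> real (tgt e) \<and> y = height e x"
  define t where "t = (x - real (src e)) / (real (tgt e) - real (src e))"
  have "real (src e) + t * (real (tgt e) - real (src e)) = x" using lt by (simp add: t_def)
  then have "zpath e t = (x, y)" using x by (simp add: zpath_def Let_def)
  moreover have "t \<in> {0..1}" using x lt by (simp add: t_def)
  ultimately show "(x, y) \<in> path_image (zpath e)" unfolding path_image_def by (metis imageI)
qed

lemma zpath_ends:
  assumes "proper_zigzag e"
  shows "pathstart (zpath e) = spine (src e)" "pathfinish (zpath e) = spine (tgt e)"
  using assms src_less_tgt[OF assms] height_nat[OF assms, of "src e"] height_nat[OF assms, of "tgt e"]
  by (simp_all add: pathstart_def pathfinish_def zpath_def Let_def spine_def lev_ends ends_def)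

lemma arc_zpath:
  assumes "proper_zigzag e"
  shows "arc (zpath e)"
proof -
  have lt: "real (src e) < real (tgt e)" using src_less_tgt[OF assms] by simp
  have "continuous_on {0..1} (\<lambda>t. real (src e) + t * (real (tgt e) - real (src e)))"
    by (intro continuous_intros)
  then have "path (zpath e)"
    unfolding path_def zpath_def Let_def height_def
    by (intro continuous_on_Pair continuous_on_compose2[OF continuous_interpol[of UNIV]]) auto
  moreover have "inj_on (zpath e) {0..1}"
    using lt by (intro inj_onI) (simp add: zpath_def Let_def)
  ultimately show ?thesis by (simp add: arc_def)
qed

lemma x_monotone_zpath: "proper_zigzag e \<Longrightarrow> x_monotone (zpath e)"
  unfolding x_monotone_def using zpath_image by (metis prod.collapse)

lemma obtain_cell:
  assumes "real a \<le> x" "x \<le> real b" "a < b"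
  obtains k where "a \<le> k" "k < b" "real k \<le> x" "x \<le> real (Suc k)"
proof (cases "x = real b")
  case True
  then show ?thesis using that[of "b - 1"] assms(3) by auto
next
  case False
  have "real (nat \<lfloor>x\<rfloor>) \<le> x" "x \<le> real (Suc (nat \<lfloor>x\<rfloor>))" "a \<le> nat \<lfloor>x\<rfloor>" "nat \<lfloor>x\<rfloor> < b"
    using assms False by linarith+
  then show ?thesis using that by blast
qed

text \<open>
  Between two columns the difference of two zigzags is a convex combination of its values in these
  columns.
\<close>

lemma height_diff_cell:
  assumes "src e \<le> k" "src f \<le> k" "k < tgt e" "k < tgt f" "real k \<le> x" "x \<le> real (Suc k)"
  shows "height f x - height e x =
    (real (Suc k) - x) * of_int (lev f k - lev e k) + (x - real k) * of_int (lev f (Suc k) - lev e (Suc k))"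
  using height_cell[of e k x] height_cell[of f k x] assms by (simp add: algebra_simps)

text \<open>
  The difference is nonnegative in all shared columns, and between two adjacent shared columns it can
  only vanish if it vanishes in both. Then both would be common ends, and the zigzags would have the same
  ends.
\<close>

lemma below_meet:
  assumes e: "proper_zigzag e" and f: "proper_zigzag f" and ne: "ends e \<noteq> ends f" and bel: "below e f"
    and x: "real (max (src e) (src f)) \<le> x" "x \<le> real (min (tgt e) (tgt f))" and eq: "height e x = height f x"
  obtains k where "x = real k" "k \<in> ends e \<inter> ends f"
proof -
  let ?lo = "max (src e) (src f)" and ?hi = "min (tgt e) (tgt f)"
  let ?D = "\<lambda>k. lev f k - lev e k"
  have D: "0 < ?D k" if "?lo \<le> k" "k \<le> ?hi" "k \<notin> ends e \<inter> ends f" for k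
  proof -
    have "lev e k < lev f k" using bel that unfolding below_def by (metis atLeastAtMost_iff)
    then show ?thesis by simp
  qed
  have D0: "?D k = 0" if "k \<in> ends e \<inter> ends f" for k
    using lev_ends[OF e, of k] lev_ends[OF f, of k] that by simp
  have at_nat: "k \<in> ends e \<inter> ends f" if "x = real k" "?lo \<le> k" "k \<le> ?hi" for k
  proof -
    have "lev e k = lev f k"
      using eq that height_nat[OF e, of k] height_nat[OF f, of k] by simp
    then have "\<not> 0 < ?D k" by simp
    then show ?thesis using D[OF that(2,3)] by blast
  qed
  have "real ?lo \<le> real ?hi" using x by linarith
  then have "?lo \<le> ?hi" by (simp only: of_nat_le_iff)
  then consider "?lo = ?hi" | "?lo < ?hi" by linarith
  then show thesis
  proof cases
    case 1
    then have "x = real ?lo" using x by simp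
    moreover from this have "?lo \<in> ends e \<inter> ends f" by (rule at_nat) (use 1 in simp_all)
    ultimately show thesis by (rule that)
  next
    case 2
    obtain k where k: "?lo \<le> k" "k < ?hi" "real k \<le> x" "x \<le> real (Suc k)"
      by (rule obtain_cell[OF x 2])
    have zero: "(real (Suc k) - x) * of_int (?D k) + (x - real k) * of_int (?D (Suc k)) = 0"
      using height_diff_cell[of e k f x] k eq by simp
    have k': "k \<le> ?hi" "?lo \<le> Suc k" "Suc k \<le> ?hi" using k(1,2) by linarith+
    have pos: "0 \<le> ?D k" "0 \<le> ?D (Suc k)"
      using D[OF k(1) k'(1)] D0[of k] D[OF k'(2,3)] D0[of "Suc k"] by linarith+
    have "x = real k \<or> x = real (Suc k)"
    proof (rule ccontr)
      assume "\<not> ?thesis"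
      then have "0 < real (Suc k) - x" "0 < x - real k" using k by auto
      moreover have "0 < ?D k \<or> 0 < ?D (Suc k)"
      proof (rule ccontr)
        assume "\<not> ?thesis"
        then have "k \<in> ends e \<inter> ends f" "Suc k \<in> ends e \<inter> ends f"
          using D[OF k(1) k'(1)] D[OF k'(2,3)] by blast+
        then have "ends e = {k, Suc k}" "ends f = {k, Suc k}" by (auto simp: ends_def)
        then show False using ne by simp
      qed
      ultimately have "0 < (real (Suc k) - x) * of_int (?D k) + (x - real k) * of_int (?D (Suc k))"
        using pos by (auto intro: add_pos_nonneg add_nonneg_pos)
      then show False using zero by simp
    qed
    then show thesis using that at_nat[OF _ k(1) k'(1)] at_nat[OF _ k'(2,3)] by blast
  qed
qed

text \<open>
  The difference has no zero to the left of column \<open>m\<close> or to the right of the next one, and it is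
  linear and decreasing in between, so the only common point is a transversal crossing of two segments.
\<close>

lemma swap_meet:
  assumes e: "proper_zigzag e" and f: "proper_zigzag f" and sw: "swap e f"
  obtains p where "properly_cross_at p (zpath e) (zpath f)" "properly_cross_at p (zpath f) (zpath e)"
    "path_image (zpath e) \<inter> path_image (zpath f) = {p}"
proof -
  let ?lo = "max (src e) (src f)" and ?hi = "min (tgt e) (tgt f)"
  let ?D = "\<lambda>k. real_of_int (lev f k - lev e k)"
  obtain m where m: "?lo \<le> m" "m < ?hi"
    and up: "\<And>k. ?lo \<le> k \<Longrightarrow> k \<le> m \<Longrightarrow> 0 < ?D k"
    and dn: "\<And>k. Suc m \<le> k \<Longrightarrow> k \<le> ?hi \<Longrightarrow> ?D k < 0"
    using sw by (force simp: swap_def)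
  have cell: "m < tgt e" "m < tgt f" "src e \<le> m" "src f \<le> m" using m by auto
  define \<alpha> \<beta> where "\<alpha> = real_of_int (lev e (Suc m)) - lev e m" and "\<beta> = real_of_int (lev f (Suc m)) - lev f m"
  have Dm: "0 < ?D m" "?D (Suc m) < 0" using up[of m] dn[of "Suc m"] m by auto
  have slope: "?D (Suc m) - ?D m = \<beta> - \<alpha>" by (simp add: \<alpha>_def \<beta>_def)
  \<comment> \<open>The difference falls from \<open>?D m\<close> at the rate \<open>\<alpha> - \<beta>\<close>, so it vanishes at distance \<open>s\<close> from \<open>m\<close>.\<close>
  define s where "s = ?D m / (\<alpha> - \<beta>)"
  have s: "0 < s" "s < 1" "s * (\<alpha> - \<beta>) = ?D m" using Dm slope by (auto simp: s_def)
  define x0 where "x0 = real m + s"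
  have x0: "real m < x0" "x0 < real (Suc m)" using s by (auto simp: x0_def)
  have hte: "height e x = lev e m + (x - real m) * \<alpha>" and htf: "height f x = lev f m + (x - real m) * \<beta>"
    if "real m \<le> x" "x \<le> real (Suc m)" for x
    using height_cell[of e m x] height_cell[of f m x] that cell by (simp_all add: \<alpha>_def \<beta>_def)
  have eq0: "height e x0 = height f x0"
    using hte[of x0] htf[of x0] x0 s(3) by (simp add: x0_def algebra_simps)
  have uniq: "x = x0" if x: "real ?lo \<le> x" "x \<le> real ?hi" "height e x = height f x" for x
  proof -
    obtain k where k: "?lo \<le> k" "k < ?hi" "real k \<le> x" "x \<le> real (Suc k)"
      using obtain_cell[OF x(1,2)] m by (metis order.strict_trans1)
    have zero: "(real (Suc k) - x) * ?D k + (x - real k) * ?D (Suc k) = 0"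
      using height_diff_cell[of e k f x] k x(3) by simp
    consider "k < m" | "k = m" | "m < k" by linarith
    then show ?thesis
    proof cases
      case 1
      then have "0 < ?D k" "0 < ?D (Suc k)" using up[of k] up[of "Suc k"] k by auto
      then have "0 < (real (Suc k) - x) * ?D k + (x - real k) * ?D (Suc k)"
        using k by (cases "x = real k") (auto intro: add_pos_nonneg add_nonneg_pos mult_pos_pos mult_nonneg_nonneg)
      then show ?thesis using zero by linarith
    next
      case 3
      then have "0 < - ?D k" "0 < - ?D (Suc k)" using dn[of k] dn[of "Suc k"] k by auto
      then have "0 < (real (Suc k) - x) * - ?D k + (x - real k) * - ?D (Suc k)"
        using k by (cases "x = real k") (auto intro: add_pos_nonneg add_nonneg_pos mult_pos_pos mult_nonneg_nonneg)
      then show ?thesis using zero by (simp only: mult_minus_right)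
    next
      case 2
      have "(x - real m) * (\<alpha> - \<beta>) = ?D m"
        using hte[of x] htf[of x] k(3,4) x(3) unfolding 2 by (simp add: algebra_simps)
      then have "(x - real m) * (\<alpha> - \<beta>) = s * (\<alpha> - \<beta>)" using s(3) by simp
      moreover have "\<alpha> - \<beta> \<noteq> 0" using slope Dm by linarith
      ultimately show ?thesis by (simp add: x0_def)
    qed
  qed
  define d where "d = min s (1 - s)"
  have d: "0 < d" using s by (simp add: d_def)
  have near: "real m \<le> x" "x \<le> real (Suc m)" if "\<bar>x - x0\<bar> < d" for x
    using that by (auto simp: d_def x0_def)
  have le: "real (src e) \<le> real m" "real (src f) \<le> real m" "real (Suc m) \<le> real (tgt e)" "real (Suc m) \<le> real (tgt f)"
    using cell by (simp_all only: of_nat_le_iff Suc_le_eq)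
  have loc_e: "(x, y) \<in> path_image (zpath e) \<longleftrightarrow> y = height e x0 + \<alpha> * (x - x0)" if "\<bar>x - x0\<bar> < d" for x y
  proof -
    have "height e x = height e x0 + \<alpha> * (x - x0)"
      using hte[of x] hte[of x0] near[OF that] x0 by (simp add: algebra_simps)
    then show ?thesis unfolding zpath_image[OF e] using near[OF that] le by auto
  qed
  have loc_f: "(x, y) \<in> path_image (zpath f) \<longleftrightarrow> y = height e x0 + \<beta> * (x - x0)" if "\<bar>x - x0\<bar> < d" for x y
  proof -
    have "height f x = height e x0 + \<beta> * (x - x0)"
      using htf[of x] htf[of x0] near[OF that] x0 eq0 by (simp add: algebra_simps)
    then show ?thesis unfolding zpath_image[OF f] using near[OF that] le by auto
  qed
  have ab: "\<alpha> \<noteq> \<beta>" using slope Dm by linarith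
  have "properly_cross_at (x0, height e x0) (zpath e) (zpath f)"
    by (rule properly_cross_at_if_locally_linear[OF d ab loc_e loc_f])
  moreover have "properly_cross_at (x0, height e x0) (zpath f) (zpath e)"
    by (rule properly_cross_at_if_locally_linear[OF d ab[symmetric] loc_f loc_e])
  moreover have "path_image (zpath e) \<inter> path_image (zpath f) = {(x0, height e x0)}"
  proof -
    have "p = (x0, height e x0)" if "p \<in> path_image (zpath e)" "p \<in> path_image (zpath f)" for p
    proof -
      obtain x y where p: "p = (x, y)" by (cases p)
      have "x = x0" using that uniq[of x] unfolding p zpath_image[OF e] zpath_image[OF f] by auto
      moreover have "y = height e x" using that unfolding p zpath_image[OF e] by simp
      ultimately show ?thesis by (simp add: p)
    qed
    moreover have "(x0, height e x0) \<in> path_image (zpath e)" "(x0, height e x0) \<in> path_image (zpath f)"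
      using loc_e[of x0] loc_f[of x0] d by simp_all
    ultimately show ?thesis by blast
  qed
  ultimately show thesis by (rule that)
qed

section \<open>Drawings by zigzags and their copies\<close>

lemma inj_spine: "inj spine"
  by (auto simp: inj_on_def spine_def)

text \<open>
  These conditions concern only finitely many levels and make the zigzags the edges of a local thrackle
  on the vertices in the columns below \<open>n\<close>. In the last one, \<open>e\<close> and \<open>f\<close> are the first and the last
  edge of a path with the middle edge \<open>g\<close>.
\<close>

locale zigzag_graph =
  fixes n :: nat and Z :: "zigzag set"
  assumes proper: "e \<in> Z \<Longrightarrow> proper_zigzag e"
    and tgt_less: "e \<in> Z \<Longrightarrow> tgt e < n"
    and distinct_ends: "\<lbrakk>e \<in> Z; f \<in> Z; e \<noteq> f\<rbrakk> \<Longrightarrow> ends e \<noteq> ends f"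
    and below_or_swap: "\<lbrakk>e \<in> Z; f \<in> Z; e \<noteq> f\<rbrakk> \<Longrightarrow>
      below e f \<or> below f e \<or> ends e \<inter> ends f = {} \<and> (swap e f \<or> swap f e)"
    and swap_if_linked: "\<lbrakk>e \<in> Z; f \<in> Z; g \<in> Z; ends e \<inter> ends f = {}; ends e \<inter> ends g \<noteq> {}; ends f \<inter> ends g \<noteq> {}\<rbrakk>
      \<Longrightarrow> swap e f \<or> swap f e"
begin

definition vertex_pair :: "zigzag \<Rightarrow> plane set" where "vertex_pair e = spine ` ends e"

definition graph :: topgraph where
  "graph = \<lparr>verts = spine ` {..<n}, edges = vertex_pair ` Z,
     curve = (\<lambda>s. zpath (the_inv_into Z vertex_pair s))\<rparr>"

lemma inj_vertex_pair: "inj_on vertex_pair Z"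
  using distinct_ends unfolding inj_on_def vertex_pair_def by (metis inj_image_eq_iff inj_spine)

lemma graph_simps:
  "verts graph = spine ` {..<n}" "edges graph = vertex_pair ` Z"
  "e \<in> Z \<Longrightarrow> curve graph (vertex_pair e) = zpath e"
  by (simp_all add: graph_def the_inv_into_f_f inj_vertex_pair)

lemma card_verts: "card (verts graph) = n"
  by (simp add: graph_simps card_image inj_on_subset[OF inj_spine])

lemma card_edges: "card (edges graph) = card Z"
  by (simp add: graph_simps card_image inj_vertex_pair)

lemma swap_cross:
  assumes "e \<in> Z" "f \<in> Z" "swap e f \<or> swap f e"
  obtains p where "properly_cross_at p (zpath e) (zpath f)"
    "path_image (zpath e) \<inter> path_image (zpath f) = {p}"
  using swap_meet[OF proper[OF assms(1)] proper[OF assms(2)]]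
    swap_meet[OF proper[OF assms(2)] proper[OF assms(1)]] assms(3) by (metis Int_commute)

lemma meet_cases:
  assumes "e \<in> Z" "f \<in> Z" "e \<noteq> f"
  obtains p where "properly_cross_at p (zpath e) (zpath f)" "path_image (zpath e) \<inter> path_image (zpath f) = {p}"
  | "path_image (zpath e) \<inter> path_image (zpath f) \<subseteq> spine ` (ends e \<inter> ends f)"
proof (cases "swap e f \<or> swap f e")
  case True
  then show thesis using swap_cross[OF assms(1,2)] that(1) by blast
next
  case False
  then have bel: "below e f \<or> below f e" using below_or_swap[OF assms] by blast
  note e = proper[OF assms(1)] and f = proper[OF assms(2)] and ne = distinct_ends[OF assms]
  have "p \<in> spine ` (ends e \<inter> ends f)" if pe: "p \<in> path_image (zpath e)" and pf: "p \<in> path_image (zpath f)" for p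
  proof -
    obtain x y where p: "p = (x, y)" by (cases p)
    have x: "real (max (src e) (src f)) \<le> x" "x \<le> real (min (tgt e) (tgt f))"
      and y: "y = height e x" "height e x = height f x"
      using pe pf unfolding p zpath_image[OF e] zpath_image[OF f] by auto
    obtain k where k: "x = real k" "k \<in> ends e \<inter> ends f"
      using bel
    proof
      assume "below e f"
      from below_meet[OF e f ne this x y(2)] show thesis using that by blast
    next
      assume "below f e"
      from below_meet[OF f e ne[symmetric] this] x y(2) show thesis
        using that by (metis Int_commute max.commute min.commute)
    qed
    have "src e \<le> k" "k \<le> tgt e" using k(2) src_less_tgt[OF e] by (auto simp: ends_def)
    then have "y = 0" using y(1) k height_nat[OF e, of k] lev_ends[OF e, of k] by simp
    then show ?thesis using k by (auto simp: p spine_def)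
  qed
  then show thesis using that(2) by blast
qed

lemma simple_graph: "simple_topological_graph graph"
proof -
  have pair: "vertex_pair e \<subseteq> verts graph \<and> card (vertex_pair e) = 2" if "e \<in> Z" for e
  proof
    have "src e < tgt e" "tgt e < n" using that by (simp_all add: src_less_tgt proper tgt_less)
    then show "vertex_pair e \<subseteq> verts graph" by (auto simp: graph_simps vertex_pair_def ends_def)
    have "card (vertex_pair e) = card (ends e)"
      unfolding vertex_pair_def by (intro card_image inj_on_subset[OF inj_spine]) simp
    then show "card (vertex_pair e) = 2" using \<open>src e < tgt e\<close> by (simp add: ends_def)
  qed
  have arc: "arc (zpath e) \<and> {pathstart (zpath e), pathfinish (zpath e)} = vertex_pair e" if "e \<in> Z" for e
    using proper[OF that] by (simp add: arc_zpath zpath_ends vertex_pair_def ends_def)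
  have avoid: "path_image (zpath e) \<inter> verts graph \<subseteq> vertex_pair e" if "e \<in> Z" for e
  proof
    note e = proper[OF that]
    fix p assume "p \<in> path_image (zpath e) \<inter> verts graph"
    then obtain k where p: "p = (real k, 0)" and "(real k, 0) \<in> path_image (zpath e)"
      by (auto simp: graph_simps spine_def)
    then have k: "src e \<le> k" "k \<le> tgt e" "height e (real k) = 0" by (auto simp: zpath_image[OF e])
    then have "lev e k = 0" using height_nat[OF e, of k] by simp
    then have "k \<in> ends e" using e k(1,2) by (simp add: proper_zigzag_def)
    then show "p \<in> vertex_pair e" by (auto simp: p vertex_pair_def spine_def)
  qed
  have cross: "properly_cross_at p (zpath e) (zpath f)"
    if ef: "e \<in> Z" "f \<in> Z" "e \<noteq> f" and p: "p \<in> arc_interior (zpath e) \<inter> arc_interior (zpath f)" for e f p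
    using ef
  proof (cases rule: meet_cases)
    case (1 q)
    then show ?thesis using p by (auto simp: arc_interior_def)
  next
    case 2
    then have "p \<in> spine ` ends e" using p by (auto simp: arc_interior_def)
    then show ?thesis using p zpath_ends[OF proper[OF ef(1)]] by (auto simp: arc_interior_def ends_def)
  qed
  have once: "p = q"
    if ef: "e \<in> Z" "f \<in> Z" "e \<noteq> f" and p: "p \<in> path_image (zpath e) \<inter> path_image (zpath f)"
      and q: "q \<in> path_image (zpath e) \<inter> path_image (zpath f)" for e f p q
    using ef
  proof (cases rule: meet_cases)
    case (1 r)
    then show ?thesis using p q by simp
  next
    case 2
    then obtain k l where kl: "p = spine k" "q = spine l" "k \<in> ends e \<inter> ends f" "l \<in> ends e \<inter> ends f"
      using p q by blast
    show ?thesis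
    proof (rule ccontr)
      assume "p \<noteq> q"
      then have "k \<noteq> l" using kl by blast
      then have "ends e = {k, l}" "ends f = {k, l}" using kl(3,4) by (auto simp: ends_def)
      then show False using distinct_ends[OF ef] by simp
    qed
  qed
  have edge: "\<exists>e \<in> Z. s = vertex_pair e \<and> curve graph s = zpath e" if "s \<in> edges graph" for s
    using that graph_simps(3) unfolding graph_simps(2) by blast
  have "topological_graph graph"
    unfolding topological_graph_def
  proof (intro conjI ballI impI)
    show "finite (verts graph)" by (simp add: graph_simps)
  next
    fix s assume "s \<in> edges graph"
    then obtain e where e: "e \<in> Z" "s = vertex_pair e" "curve graph s = zpath e" using edge by blast
    show "s \<subseteq> verts graph" "card s = 2" "arc (curve graph s)"
      "{pathstart (curve graph s), pathfinish (curve graph s)} = s" "path_image (curve graph s) \<inter> verts graph \<subseteq> s"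
      unfolding e(3) using pair[OF e(1)] arc[OF e(1)] avoid[OF e(1)] by (simp_all add: e(2))
    fix t p assume "t \<in> edges graph" and "s \<noteq> t"
      and p: "p \<in> arc_interior (curve graph s) \<inter> arc_interior (curve graph t)"
    then obtain f where f: "f \<in> Z" "t = vertex_pair f" "curve graph t = zpath f" using edge by blast
    have "e \<noteq> f" using \<open>s \<noteq> t\<close> e(2) f(2) by blast
    then show "properly_cross_at p (curve graph s) (curve graph t)"
      using p cross[OF e(1) f(1)] unfolding e(3) f(3) by blast
  qed
  moreover have "p = q" if st: "s \<in> edges graph" "t \<in> edges graph" "s \<noteq> t"
    "p \<in> path_image (curve graph s) \<inter> path_image (curve graph t)"
    "q \<in> path_image (curve graph s) \<inter> path_image (curve graph t)" for s t p q
  proof -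
    obtain e f where ef: "e \<in> Z" "s = vertex_pair e" "curve graph s = zpath e"
      "f \<in> Z" "t = vertex_pair f" "curve graph t = zpath f" using edge[OF st(1)] edge[OF st(2)] by blast
    have "e \<noteq> f" using st(3) ef(2,5) by blast
    then show ?thesis using st(4,5) once[OF ef(1,4)] unfolding ef(3,6) by blast
  qed
  ultimately show ?thesis unfolding simple_topological_graph_def by blast
qed

lemma local_thrackle_graph: "local_thrackle graph"
proof -
  have False if plane: "plane_path3 graph a b c d" for a b c d
  proof -
    have "path3 graph a b c d"
      and cr: "\<forall>s \<in> {{a, b}, {b, c}, {c, d}}. \<forall>t \<in> {{a, b}, {b, c}, {c, d}}. s \<noteq> t \<longrightarrow>
        \<not> arcs_cross (curve graph s) (curve graph t)"
      using plane unfolding plane_path3_def by (rule conjunct1, rule conjunct2)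
    then have dist: "distinct [a, b, c, d]"
      and ed: "{a, b} \<in> edges graph" "{b, c} \<in> edges graph" "{c, d} \<in> edges graph"
      by (simp_all only: path3_def)
    have "{a, b} \<noteq> {c, d}" using dist by (simp add: doubleton_eq_iff)
    then have nocross: "\<not> arcs_cross (curve graph {a, b}) (curve graph {c, d})"
      by (intro cr[rule_format]) simp_all
    obtain e where e: "{a, b} = vertex_pair e" "e \<in> Z"
      using ed(1) unfolding graph_simps(2) by (rule imageE)
    obtain g where g: "{b, c} = vertex_pair g" "g \<in> Z"
      using ed(2) unfolding graph_simps(2) by (rule imageE)
    obtain f where f: "{c, d} = vertex_pair f" "f \<in> Z"
      using ed(3) unfolding graph_simps(2) by (rule imageE)
    have meet: "ends x \<inter> ends y = {} \<longleftrightarrow> vertex_pair x \<inter> vertex_pair y = {}" for x y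
      unfolding vertex_pair_def image_Int[OF inj_spine, symmetric] by simp
    have "ends e \<inter> ends f = {}" "ends e \<inter> ends g \<noteq> {}" "ends f \<inter> ends g \<noteq> {}"
      unfolding meet e(1)[symmetric] f(1)[symmetric] g(1)[symmetric] using dist by simp_all
    then have "swap e f \<or> swap f e" using swap_if_linked e(2) f(2) g(2) by blast
    then obtain p where "properly_cross_at p (zpath e) (zpath f)" by (rule swap_cross[OF e(2) f(2)])
    then have "arcs_cross (curve graph {a, b}) (curve graph {c, d})"
      unfolding e(1) f(1) graph_simps(3)[OF e(2)] graph_simps(3)[OF f(2)] arcs_cross_def by blast
    then show False using nocross by blast
  qed
  then show ?thesis using simple_graph unfolding local_thrackle_def by blast
qed

lemma x_monotone_graph: "x_monotone_edges graph"
  unfolding x_monotone_edges_def graph_simps(2) by (auto simp: graph_simps(3) x_monotone_zpath proper)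

end

definition translate :: "nat \<Rightarrow> zigzag \<Rightarrow> zigzag" where "translate s e = (s + fst e, snd e)"

lemma translate_simps:
  assumes "proper_zigzag e"
  shows "src (translate s e) = s + src e" "tgt (translate s e) = s + tgt e"
    "ends (translate s e) = (+) s ` ends e" "lev (translate s e) (s + k) = lev e k"
  using assms by (auto simp: translate_def src_def ends_def tgt_def lev_def proper_zigzag_def)

lemma ball_shift: "(\<forall>k \<in> {s + a..s + b}. P k) \<longleftrightarrow> (\<forall>k \<in> {a..b}. P (s + k))" for s :: nat
proof -
  have shift: "{s + a..s + b} = (+) s ` {a..b}" by (simp add: add.commute)
  show ?thesis unfolding shift by blast
qed

lemma shift_mem: "s + k \<in> (+) s ` A \<longleftrightarrow> k \<in> A" for s :: nat
  by auto

lemma proper_translate: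
  assumes "proper_zigzag e"
  shows "proper_zigzag (translate s e)"
proof -
  have "2 \<le> length (snd (translate s e))" using assms by (simp add: translate_def proper_zigzag_def)
  moreover have "\<forall>k \<in> {src (translate s e)..tgt (translate s e)}.
      lev (translate s e) k = 0 \<longleftrightarrow> k \<in> ends (translate s e)"
    unfolding translate_simps[OF assms] ball_shift shift_mem
    using assms unfolding proper_zigzag_def by blast
  ultimately show ?thesis unfolding proper_zigzag_def ..
qed

lemma translate_below:
  assumes "proper_zigzag e" "proper_zigzag f" "below e f"
  shows "below (translate s e) (translate s f)"
  using assms(3) unfolding below_def translate_simps[OF assms(1)] translate_simps[OF assms(2)]
    max_add_distrib_right[symmetric] min_add_distrib_right[symmetric] ball_shift Int_iff shift_mem .

lemma translate_swap:
  assumes "proper_zigzag e" "proper_zigzag f" "swap e f"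
  shows "swap (translate s e) (translate s f)"
proof -
  let ?lo = "max (src e) (src f)" and ?hi = "min (tgt e) (tgt f)"
  obtain m where m: "?lo \<le> m" "m < ?hi" "\<forall>k \<in> {?lo..m}. lev e k < lev f k" "\<forall>k \<in> {Suc m..?hi}. lev f k < lev e k"
    using assms(3) unfolding swap_def by auto
  have "\<forall>k \<in> {s + ?lo..s + m}. lev (translate s e) k < lev (translate s f) k"
    "\<forall>k \<in> {s + Suc m..s + ?hi}. lev (translate s f) k < lev (translate s e) k"
    unfolding ball_shift using m(3,4) by (simp_all add: translate_simps assms)
  then show ?thesis
    unfolding swap_def translate_simps[OF assms(1)] translate_simps[OF assms(2)]
      max_add_distrib_right[symmetric] min_add_distrib_right[symmetric]
    using m(1,2) by (intro bexI[of _ "s + m"]) auto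
qed

text \<open>
  Copies in different blocks of \<open>w\<close> columns share no column, so they are vacuously below each other and
  no edge links them. Within a block all conditions are invariant under translation.
\<close>

lemma zigzag_graph_copies:
  assumes base: "zigzag_graph w X" and n: "w * q \<le> n"
  defines "T \<equiv> \<lambda>(c, e). translate (w * c) e"
  shows "zigzag_graph n (T ` ({..<q} \<times> X))" and "inj_on T ({..<q} \<times> X)"
proof -
  interpret zigzag_graph w X by (rule base)
  let ?C = "{..<q} \<times> X"
  note tr = translate_simps[OF proper]
  have ends_T: "ends (T (c, e)) = (+) (w * c) ` ends e" if "e \<in> X" for c e
    unfolding T_def case_prod_conv by (rule tr(3)[OF that])
  have ends_less: "k < w" if "e \<in> X" "k \<in> ends e" for e k
    using that(2) tgt_less[OF that(1)] src_less_tgt[OF proper[OF that(1)]] by (auto simp: ends_def)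
  have same: "c = c'"
    if ef: "e \<in> X" "f \<in> X" and meet: "ends (T (c, e)) \<inter> ends (T (c', f)) \<noteq> {}" for c c' e f
  proof -
    obtain k l where kl: "k \<in> ends e" "l \<in> ends f" "w * c + k = w * c' + l"
      using meet unfolding ends_T[OF ef(1)] ends_T[OF ef(2)] by blast
    have "c = (w * c + k) div w" "c' = (w * c' + l) div w"
      using ends_less[OF ef(1) kl(1)] ends_less[OF ef(2) kl(2)] by simp_all
    then show "c = c'" using kl(3) by simp
  qed
  have ends_eq: "e = f" if "e \<in> X" "f \<in> X" "ends (T (c, e)) = ends (T (c, f))" for c e f
    using that(3) distinct_ends[OF that(1,2)] unfolding ends_T[OF that(1)] ends_T[OF that(2)]
    by (simp add: inj_image_eq_iff) blast
  have ends_ne: "ends e \<noteq> {}" for e by (simp add: ends_def)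
  have inj: "c = c' \<and> e = f" if "e \<in> X" "f \<in> X" "ends (T (c, e)) = ends (T (c', f))" for c c' e f
  proof -
    have "c = c'" using same[OF that(1,2), of c c'] that(3) ends_ne by simp
    then show ?thesis using ends_eq[OF that(1,2), of c] that(3) by simp
  qed
  show "inj_on T ?C"
  proof (rule inj_onI)
    fix x y assume "x \<in> ?C" "y \<in> ?C" "T x = T y"
    then have "fst x = fst y \<and> snd x = snd y" by (intro inj) (simp_all add: mem_Times_iff)
    then show "x = y" by (simp add: prod_eq_iff)
  qed
  have apart: "below (T (c, e)) (T (c', f)) \<and> below (T (c', f)) (T (c, e))"
    if "e \<in> X" "f \<in> X" "c < c'" for c c' e f
  proof -
    have "w * Suc c \<le> w * c'" using that(3) by (intro mult_le_mono2) simp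
    then have "tgt (T (c, e)) < src (T (c', f))"
      using tgt_less[OF that(1)] by (simp add: T_def tr that)
    then show ?thesis by (auto simp: below_def)
  qed
  show "zigzag_graph n (T ` ?C)"
  proof
    fix e' assume "e' \<in> T ` ?C"
    then obtain c e where e': "e' = T (c, e)" and c: "c < q" and e: "e \<in> X" by blast
    show "proper_zigzag e'" unfolding e' T_def using proper_translate proper e by simp
    have "w * Suc c \<le> w * q" using c by (intro mult_le_mono2) simp
    then show "tgt e' < n" using tgt_less[OF e] n by (simp add: e' T_def tr e)
  next
    fix e' f' assume "e' \<in> T ` ?C" "f' \<in> T ` ?C" and ne: "e' \<noteq> f'"
    then obtain c e d f where e': "e' = T (c, e)" and f': "f' = T (d, f)" and e: "e \<in> X" and f: "f \<in> X"
      by blast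
    show "ends e' \<noteq> ends f'" using inj[OF e f, of c d] ne unfolding e' f' by blast
    show "below e' f' \<or> below f' e' \<or> ends e' \<inter> ends f' = {} \<and> (swap e' f' \<or> swap f' e')"
    proof (cases "c = d")
      case False
      then have "c < d \<or> d < c" by linarith
      then show ?thesis using apart[OF e f, of c d] apart[OF f e, of d c] unfolding e' f' by blast
    next
      case True
      then have "e \<noteq> f" using ne unfolding e' f' by blast
      from below_or_swap[OF e f this] show ?thesis
        using translate_below[OF proper[OF e] proper[OF f], of "w * c"]
          translate_below[OF proper[OF f] proper[OF e], of "w * c"]
          translate_swap[OF proper[OF e] proper[OF f], of "w * c"]
          translate_swap[OF proper[OF f] proper[OF e], of "w * c"]
        unfolding e' f' T_def case_prod_conv True[symmetric] tr(3)[OF e] tr(3)[OF f]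
        by (auto simp: image_Int[symmetric])
    qed
  next
    fix e' f' g' assume "e' \<in> T ` ?C" "f' \<in> T ` ?C" "g' \<in> T ` ?C"
      and meet: "ends e' \<inter> ends f' = {}" "ends e' \<inter> ends g' \<noteq> {}" "ends f' \<inter> ends g' \<noteq> {}"
    then obtain c e d f b g where e': "e' = T (c, e)" and f': "f' = T (d, f)" and g': "g' = T (b, g)"
      and X: "e \<in> X" "f \<in> X" "g \<in> X"
      by blast
    have c: "d = c" "b = c"
      using same[OF X(1,3), of c b] same[OF X(2,3), of d b] meet(2,3) unfolding e' f' g' by blast+
    have "ends e \<inter> ends f = {}" "ends e \<inter> ends g \<noteq> {}" "ends f \<inter> ends g \<noteq> {}"
      using meet unfolding e' f' g' c T_def case_prod_conv tr(3)[OF X(1)] tr(3)[OF X(2)] tr(3)[OF X(3)]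
      by (simp_all add: image_Int[symmetric])
    from swap_if_linked[OF X this] show "swap e' f' \<or> swap f' e'"
      using translate_swap[OF proper[OF X(1)] proper[OF X(2)], of "w * c"]
        translate_swap[OF proper[OF X(2)] proper[OF X(1)], of "w * c"]
      unfolding e' f' c T_def case_prod_conv by blast
  qed
qed

section \<open>Three linked triangles\<close>

text \<open>
  The triangles on the columns \<open>i, i + 3, i + 6\<close> for \<open>i = 0, 1, 2\<close>, one per line, and the edges from
  column \<open>1\<close> to \<open>6\<close> and from \<open>2\<close> to \<open>7\<close>, which link consecutive triangles. A third of the vertices,
  those in the columns \<open>3, 4, 5\<close>, are two-sided. The levels in a column only encode the order in which
  the zigzags and the vertex appear there, from bottom to top.
\<close>

definition triangle_chain :: "zigzag list" where
  "triangle_chain =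
    [(0, [0, -1, 2, 0]), (0, [0, 1, 3, 1, -3, -2, 0]), (3, [0, -4, -3, 0]),
     (1, [0, -1, -2, 0]), (1, [0, 1, -1, 1, -1, 1, 0]), (4, [0, -5, -1, 0]),
     (2, [0, -4, -2, 0]), (2, [0, -3, -1, 1, 2, 1, 0]), (5, [0, -3, -1, 0]),
     (1, [0, -2, -5, -5, -4, 0]), (2, [0, -6, -6, -6, -2, 0])]"

lemma atLeastAtMost_nat_numeral:
  "{m..numeral k :: nat} = (if m \<le> numeral k then insert (numeral k) {m..pred_numeral k} else {})"
  by (auto simp: numeral_eq_Suc)

lemma sorted_wrt_related:
  "\<lbrakk>sorted_wrt R xs; x \<in> set xs; y \<in> set xs; x \<noteq> y\<rbrakk> \<Longrightarrow> R x y \<or> R y x"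
  by (induction xs) auto

text \<open>
  The conditions on pairs are symmetric, so they are computed only for pairs of a zigzag and a later one
  in the list. Nonadjacent zigzags must cross if some edge of the drawing meets an end of each, which is
  what \<open>linked\<close> expresses.
\<close>

lemma zigzag_graph_triangle_chain: "zigzag_graph 9 (set triangle_chain)"
proof -
  define linked where "linked e f \<longleftrightarrow>
    (\<exists>g \<in> set triangle_chain. ends e \<inter> ends g \<noteq> {} \<and> ends f \<inter> ends g \<noteq> {})" for e f
  define R where "R e f \<longleftrightarrow> (if ends e \<inter> ends f \<noteq> {} then ends e \<noteq> ends f \<and> (below e f \<or> below f e)
    else if linked e f then swap e f \<or> swap f e
    else below e f \<or> below f e \<or> swap e f \<or> swap f e)" for e f
  note compute = triangle_chain_def below_def swap_def proper_zigzag_def src_def tgt_def ends_def lev_def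
    atLeastAtMostSuc_conv atLeastLessThanSuc atLeastAtMost_nat_numeral atLeastLessThan_nat_numeral
    doubleton_eq_iff
  have single: "\<forall>e \<in> set triangle_chain. proper_zigzag e \<and> tgt e < 9"
    by (simp add: compute)
  have sorted: "sorted_wrt R triangle_chain"
    unfolding R_def linked_def by (simp add: compute)
  have linked_sym: "linked f e \<longleftrightarrow> linked e f" for e f unfolding linked_def by blast
  have R_sym: "R f e \<longleftrightarrow> R e f" for e f
    unfolding R_def Int_commute[of "ends f" "ends e"] linked_sym[of f e] by auto
  have pair: "R e f" if "e \<in> set triangle_chain" "f \<in> set triangle_chain" "e \<noteq> f" for e f
    using sorted_wrt_related[OF sorted that] R_sym[of f e] by simp
  have nonempty: "ends e \<noteq> {}" for e by (simp add: ends_def)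
  show ?thesis
  proof
    fix e assume "e \<in> set triangle_chain"
    then show "proper_zigzag e" "tgt e < 9" using single by blast+
  next
    fix e f assume "e \<in> set triangle_chain" "f \<in> set triangle_chain" "e \<noteq> f"
    from pair[OF this] show "ends e \<noteq> ends f"
      and "below e f \<or> below f e \<or> ends e \<inter> ends f = {} \<and> (swap e f \<or> swap f e)"
      using nonempty[of e] unfolding R_def by (auto split: if_splits)
  next
    fix e f g assume efg: "e \<in> set triangle_chain" "f \<in> set triangle_chain" "g \<in> set triangle_chain"
      and meet: "ends e \<inter> ends f = {}" "ends e \<inter> ends g \<noteq> {}" "ends f \<inter> ends g \<noteq> {}"
    have "e \<noteq> f" using meet(1) nonempty[of e] by auto
    moreover have "linked e f" unfolding linked_def using efg(3) meet(2,3) by blast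
    ultimately show "swap e f \<or> swap f e" using pair[OF efg(1,2)] meet(1) by (simp add: R_def)
  qed
qed

lemma card_triangle_chain: "card (set triangle_chain) = 11"
  by (simp add: triangle_chain_def)

section \<open>The bounds for monotone local thrackles\<close>

theorem proposition1p6:
  "(\<forall>(n::nat) G. local_thrackle G \<and> x_monotone_edges G \<and> card (verts G) = n \<longrightarrow>
      real (card (edges G)) \<le> 4 / 3 * real n) \<and>
   (\<exists>C::real. \<forall>n::nat. n > 0 \<longrightarrow>
      (\<exists>G. local_thrackle G \<and> x_monotone_edges G \<and> card (verts G) = n \<and>
        real (card (edges G)) \<ge> 6 / 5 * real n - C))"
proof
  show "\<forall>(n::nat) G. local_thrackle G \<and> x_monotone_edges G \<and> card (verts G) = n \<longrightarrow>
      real (card (edges G)) \<le> 4 / 3 * real n"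
  proof (intro allI impI)
    fix n :: nat and G assume G: "local_thrackle G \<and> x_monotone_edges G \<and> card (verts G) = n"
    then interpret monotone_local_thrackle G by unfold_locales simp_all
    have "real (3 * card (edges G)) \<le> real (4 * card (verts G))" using edges_le by (simp only: of_nat_le_iff)
    then show "real (card (edges G)) \<le> 4 / 3 * real n" using G by simp
  qed
  show "\<exists>C::real. \<forall>n::nat. n > 0 \<longrightarrow>
      (\<exists>G. local_thrackle G \<and> x_monotone_edges G \<and> card (verts G) = n \<and>
        real (card (edges G)) \<ge> 6 / 5 * real n - C)"
  proof (intro exI[of _ 10] allI impI)
    fix n :: nat
    define Z where "Z = (\<lambda>(c, e). translate (9 * c) e) ` ({..<n div 9} \<times> set triangle_chain)"
    \<comment> \<open>As \<open>11 * ((n - 8) / 9) \<ge> 11 / 9 * n - 88 / 9\<close>, the constant \<open>10\<close> suffices.\<close>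
    have "9 * (n div 9) \<le> n" by simp
    note copies = zigzag_graph_copies[OF zigzag_graph_triangle_chain this]
    interpret zigzag_graph n Z unfolding Z_def by (rule copies(1))
    have "card Z = 11 * (n div 9)"
      unfolding Z_def card_image[OF copies(2)] by (simp add: card_cartesian_product card_triangle_chain)
    moreover have "n < 9 * (n div 9) + 9" by (metis dividend_less_times_div mult.commute add.commute zero_less_numeral)
    then have "real n < 9 * real (n div 9) + 9" by linarith
    ultimately have "6 / 5 * real n - 10 \<le> real (card (edges graph))" by (simp add: card_edges)
    then show "\<exists>G. local_thrackle G \<and> x_monotone_edges G \<and> card (verts G) = n \<and>
        real (card (edges G)) \<ge> 6 / 5 * real n - 10"
      by (intro exI[of _ graph] conjI local_thrackle_graph x_monotone_graph card_verts)
  qed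
qed

end
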